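(* Let $\mu\in X_*\cap cl(\mathcal C)$ be a dominant cocharacter and $J\subseteq S_{\rm aff}$. Then $$\mathrm{Adm}^J(\mu)\cap\widetilde W^J=\mathrm{Adm}(\mu)\cap\widetilde W^J.$$
   Context: Let $(X^*,X_*,R,R^\vee,\Pi)$ be a based reduced root system (root datum) with perfect pairing $\langle\,,\rangle: X^*\times X_*\to\mathbb Z$, simple roots $\Pi$, positive roots $R_+$. Put $V=X_*\otimes\mathbb R$. An affine root is $\tilde\alpha=\alpha+k$ with $\alpha\in R$, $k\in\mathbb Z$; its reflection is $s_{\tilde\alpha}(x)=x-(\langle\alpha,x\rangle+k)\alpha^\vee$, with fixed hyperplane $H_{\tilde\alpha}\subset V$. $W$ is the finite Weyl group, $W_{\rm aff}$ the group generated by all $s_{\tilde\alpha}$, and $\widetilde W=X_*\rtimes W$ the extended affine Weyl group acting on $V$; $t_\lambda\in\widetilde W$ denotes translation by $\lambda\in X_*$. Alcoves are the connected components of $V$ minus all affine root hyperplanes. $cl(\cdot)$ denotes closure. The dominant chamber is $\mathcal C=\{x\in V: \langle\alpha,x\rangle>0\ \forall\alpha\in\Pi\}$, and the base alcove is $\bar{\bf a}=\{x\in V: -1<\langle\alpha,x\rangle<0\ \forall \alpha\in R_+\}$. $S_{\rm aff}$ is the set of reflections in the walls of $\bar{\bf a}$; $(W_{\rm aff},S_{\rm aff})$ is a Coxeter system. $\Omega$ is the stabilizer of $\bar{\bf a}$ in $\widetilde W$, so $\widetilde W=W_{\rm aff}\rtimes\Omega$. The Bruhat order on $\widetilde W$: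 for $u,u'\in W_{\rm aff}$, $\tau,\tau'\in\Omega$, $u\tau\le u'\tau'$ iff $\tau=\tau'$ and $u\le u'$ in $W_{\rm aff}$; the length is $\ell(u\tau)=\ell(u)$. For $\mu\in X_*$, $\tau_\mu\in\Omega$ is defined by $t_\mu\in W_{\rm aff}\tau_\mu$. For $J\subseteq S_{\rm aff}$, $W_J\subseteq W_{\rm aff}$ is the subgroup generated by $J$, and $\widetilde W^J$ is the set of minimal length elements of the cosets $xW_J$, $x\in\widetilde W$. For $\mu$ dominant: $\mathrm{Adm}(\mu)=\{x\in W_{\rm aff}\tau_\mu : x\le t_\lambda \text{ for some }\lambda\in W\mu\}$ and $\mathrm{Adm}^J(\mu)=W_J\,\mathrm{Adm}(\mu)\,W_J$. *)

theory Defs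
  imports "HOL-Analysis.Analysis" "HOL-Algebra.Bij" "HOL-Algebra.Generated_Groups"
begin

section \<open>Abelian groups as \<open>\<int>\<close>-modules\<close>

definition zscale :: "int \<Rightarrow> 'a::ab_group_add \<Rightarrow> 'a"
  where "zscale k x = (\<Sum>i<nat k. x) - (\<Sum>i<nat (- k). x)"

lemma zscale_diff: "zscale (int m - int n) x = (\<Sum>i<m. x) - (\<Sum>i<n. x)"
proof -
  have add: "(\<Sum>i<p + q. x) = (\<Sum>i<p. x) + (\<Sum>i<q. x)" for p q :: nat
    by (induction q) (simp_all add: add.assoc)
  show ?thesis
  proof (cases "n \<le> m")
    case True
    then obtain d where "m = n + d" using le_Suc_ex by blast
    then show ?thesis by (simp add: zscale_def add)
  next
    case False
    then obtain d where "n = m + d" using le_Suc_ex nat_le_linear by blast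
    then show ?thesis by (simp add: zscale_def add)
  qed
qed

interpretation int_module: module "zscale :: int \<Rightarrow> 'a::ab_group_add \<Rightarrow> 'a"
proof
  have add: "(\<Sum>i<p + q. x) = (\<Sum>i<p. x) + (\<Sum>i<q. x)" for p q :: nat and x :: 'a
    by (induction q) (simp_all add: add.assoc)
  fix a b :: int and x y :: 'a
  show "zscale a (x + y) = zscale a x + zscale a y"
    by (simp add: zscale_def sum.distrib)
  obtain m n where a: "a = int m - int n" by (metis int_diff_cases)
  obtain p q where b: "b = int p - int q" by (metis int_diff_cases)
  have "a + b = int (m + p) - int (n + q)" using a b by simp
  then show left: "zscale (a + b) x = zscale a x + zscale b x"
    using a b by (simp only: zscale_diff add) (simp add: algebra_simps)
  have "(\<Sum>i<(r::nat) * s. x) = (\<Sum>i<r. \<Sum>j<s. x)" for r s :: nat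
    by (induction r) (simp_all add: add add.commute)
  then have mult: "(\<Sum>i<(r::nat). (\<Sum>j<s. x) - (\<Sum>j<t. x)) = (\<Sum>i<r * s. x) - (\<Sum>i<r * t. x)"
    for r s t :: nat by (simp add: sum_subtractf)
  have "a * b = int (m * p + n * q) - int (m * q + n * p)"
    unfolding a b by (simp add: algebra_simps)
  then show "zscale a (zscale b x) = zscale (a * b) x"
    using a b by (simp only: zscale_diff mult add) (simp add: algebra_simps)
  show "zscale 1 x = x" by (simp add: zscale_def)
qed

definition is_zbasis :: "'a::ab_group_add set \<Rightarrow> bool"
  where "is_zbasis B \<longleftrightarrow>
    finite B \<and> int_module.independent B \<and> int_module.span B = UNIV"

section \<open>Based reduced root data\<close>

text \<open>The character lattice \<open>X\<^sup>*\<close> is the type \<^typ>\<open>'x\<close>, the cocharacter lattice \<open>X\<^sub>*\<close> is the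
  type \<^typ>\<open>'y\<close>. The set of coroots is \<open>coroot ` roots\<close>.\<close>

record ('x, 'y) root_datum =
  pairing :: "'x \<Rightarrow> 'y \<Rightarrow> int"
  roots :: "'x set"
  coroot :: "'x \<Rightarrow> 'y"
  simple_roots :: "'x set"

definition positive_roots :: "('x::ab_group_add, 'y, 'm) root_datum_scheme \<Rightarrow> 'x set"
  where "positive_roots D = {\<alpha> \<in> roots D.
    \<exists>c :: 'x \<Rightarrow> nat. \<alpha> = (\<Sum>\<beta>\<in>simple_roots D. zscale (int (c \<beta>)) \<beta>)}"

locale based_reduced_root_datum =
  fixes D :: "('x::ab_group_add, 'y::ab_group_add, 'm) root_datum_scheme"
  assumes free_characters: "\<exists>B :: 'x set. is_zbasis B"
    and free_cocharacters: "\<exists>B :: 'y set. is_zbasis B"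
    and pairing_additive_right: "\<And>x. Modules.additive (pairing D x)"
    and pairing_additive_left: "\<And>y. Modules.additive (\<lambda>x. pairing D x y)"
    and perfect_right: "\<And>f. Modules.additive f \<Longrightarrow> \<exists>!x. f = pairing D x"
    and perfect_left: "\<And>f. Modules.additive f \<Longrightarrow> \<exists>!y. f = (\<lambda>x. pairing D x y)"
    and finite_roots: "finite (roots D)"
    and coroot_inj: "inj_on (coroot D) (roots D)"
    and pairing_coroot: "\<And>\<alpha>. \<alpha> \<in> roots D \<Longrightarrow> pairing D \<alpha> (coroot D \<alpha>) = 2"
    and reflect_roots: "\<And>\<alpha> \<beta>. \<alpha> \<in> roots D \<Longrightarrow> \<beta> \<in> roots D \<Longrightarrow>
      \<beta> - zscale (pairing D \<beta> (coroot D \<alpha>)) \<alpha> \<in> roots D"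
    and reflect_coroots: "\<And>\<alpha> \<beta>. \<alpha> \<in> roots D \<Longrightarrow> \<beta> \<in> roots D \<Longrightarrow>
      coroot D \<beta> - zscale (pairing D \<alpha> (coroot D \<beta>)) (coroot D \<alpha>) \<in> coroot D ` roots D"
    and reduced: "\<And>\<alpha> \<beta> m n. \<alpha> \<in> roots D \<Longrightarrow> \<beta> \<in> roots D \<Longrightarrow> m \<noteq> 0 \<Longrightarrow>
      zscale m \<beta> = zscale n \<alpha> \<Longrightarrow> \<beta> = \<alpha> \<or> \<beta> = - \<alpha>"
    and simple_subset: "simple_roots D \<subseteq> roots D"
    and simple_independent: "int_module.independent (simple_roots D)"
    and simple_base: "\<And>\<alpha>. \<alpha> \<in> roots D \<Longrightarrow> \<alpha> \<in> positive_roots D \<or> - \<alpha> \<in> positive_roots D"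

section \<open>The real vector space \<open>V = X\<^sub>* \<otimes> \<real>\<close>\<close>

text \<open>The tensor product is presented by the map \<open>emb\<close>, sending \<open>\<nu>\<close> to \<open>\<nu> \<otimes> 1\<close>, into a
  real vector space in which the image of a \<open>\<int>\<close>-basis of \<open>X\<^sub>*\<close> is an \<open>\<real>\<close>-basis. The norm on \<open>V\<close>
  only provides the topology; as \<open>V\<close> is finite-dimensional, this is the usual one for every
  norm. (The class \<^class>\<open>euclidean_space\<close> would exclude root data of rank 0.)\<close>

record ('x, 'y, 'v) real_root_datum = "('x, 'y) root_datum" +
  emb :: "'y \<Rightarrow> 'v"

locale based_reduced_real_root_datum = based_reduced_root_datum D
  for D :: "('x::ab_group_add, 'y::ab_group_add, 'v::real_normed_vector) real_root_datum" +
  assumes emb_additive: "Modules.additive (emb D)"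
    and emb_basis: "\<exists>B. is_zbasis B \<and> inj_on (emb D) B \<and>
      independent (emb D ` B) \<and> span (emb D ` B) = UNIV"

text \<open>The \<open>\<real>\<close>-linear extension of the pairing.\<close>

definition real_pairing ::
  "('x, 'y, 'v::real_normed_vector) real_root_datum \<Rightarrow> 'x \<Rightarrow> 'v \<Rightarrow> real"
  where "real_pairing D x =
    (THE f. linear f \<and> (\<forall>y. f (emb D y) = of_int (pairing D x y)))"

section \<open>Affine reflections, chambers and alcoves\<close>

text \<open>The affine root \<open>\<alpha> + k\<close> is given by the two arguments \<open>\<alpha>\<close> and \<open>k\<close>.\<close>

definition affine_reflection ::
  "('x, 'y, 'v::real_normed_vector) real_root_datum \<Rightarrow> 'x \<Rightarrow> int \<Rightarrow> 'v \<Rightarrow> 'v"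
  where "affine_reflection D \<alpha> k x =
    x - (real_pairing D \<alpha> x + of_int k) *\<^sub>R emb D (coroot D \<alpha>)"

definition affine_hyperplane ::
  "('x, 'y, 'v::real_normed_vector) real_root_datum \<Rightarrow> 'x \<Rightarrow> int \<Rightarrow> 'v set"
  where "affine_hyperplane D \<alpha> k = {x. affine_reflection D \<alpha> k x = x}"

definition dominant_chamber ::
  "('x, 'y, 'v::real_normed_vector) real_root_datum \<Rightarrow> 'v set"
  where "dominant_chamber D = {x. \<forall>\<alpha>\<in>simple_roots D. real_pairing D \<alpha> x > 0}"

definition base_alcove ::
  "('x::ab_group_add, 'y, 'v::real_normed_vector) real_root_datum \<Rightarrow> 'v set"
  where "base_alcove D =
    {x. \<forall>\<alpha>\<in>positive_roots D. -1 < real_pairing D \<alpha> x \<and> real_pairing D \<alpha> x < 0}"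

text \<open>A wall of the base alcove is an affine root hyperplane that is spanned by its
  intersection with the closure of the alcove.\<close>

definition is_wall ::
  "('x::ab_group_add, 'y, 'v::real_normed_vector) real_root_datum \<Rightarrow> 'x \<Rightarrow> int \<Rightarrow> bool"
  where "is_wall D \<alpha> k \<longleftrightarrow> \<alpha> \<in> roots D \<and>
    affine hull (affine_hyperplane D \<alpha> k \<inter> closure (base_alcove D)) = affine_hyperplane D \<alpha> k"

section \<open>Weyl groups\<close>

text \<open>All Weyl groups are groups of transformations of \<open>V\<close>, with composition as product;
  the actions of \<open>W\<close> and of \<open>X\<^sub>* \<rtimes> W\<close> on \<open>V\<close> are faithful.\<close>

definition generated :: "('v \<Rightarrow> 'v) set \<Rightarrow> ('v \<Rightarrow> 'v) set"
  where "generated S = generate (BijGroup UNIV) S"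

definition finite_weyl ::
  "('x, 'y, 'v::real_normed_vector) real_root_datum \<Rightarrow> ('v \<Rightarrow> 'v) set"
  where "finite_weyl D = generated {affine_reflection D \<alpha> 0 | \<alpha>. \<alpha> \<in> roots D}"

definition affine_weyl ::
  "('x, 'y, 'v::real_normed_vector) real_root_datum \<Rightarrow> ('v \<Rightarrow> 'v) set"
  where "affine_weyl D = generated {affine_reflection D \<alpha> k | \<alpha> k. \<alpha> \<in> roots D}"

definition transl ::
  "('x, 'y, 'v::real_normed_vector) real_root_datum \<Rightarrow> 'y \<Rightarrow> 'v \<Rightarrow> 'v"
  where "transl D \<nu> x = x + emb D \<nu>"

definition ext_weyl ::
  "('x, 'y, 'v::real_normed_vector) real_root_datum \<Rightarrow> ('v \<Rightarrow> 'v) set"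
  where "ext_weyl D = {transl D \<nu> \<circ> w | \<nu> w. w \<in> finite_weyl D}"

definition simple_reflections ::
  "('x::ab_group_add, 'y, 'v::real_normed_vector) real_root_datum \<Rightarrow> ('v \<Rightarrow> 'v) set"
  where "simple_reflections D = {affine_reflection D \<alpha> k | \<alpha> k. is_wall D \<alpha> k}"

definition alcove_stabilizer ::
  "('x::ab_group_add, 'y, 'v::real_normed_vector) real_root_datum \<Rightarrow> ('v \<Rightarrow> 'v) set"
  where "alcove_stabilizer D = {\<tau> \<in> ext_weyl D. \<tau> ` base_alcove D = base_alcove D}"

section \<open>Length and Bruhat order\<close>

definition word_length :: "('v \<Rightarrow> 'v) set \<Rightarrow> ('v \<Rightarrow> 'v) \<Rightarrow> nat"
  where "word_length S w =
    (LEAST n. \<exists>ss. length ss = n \<and> set ss \<subseteq> S \<and> w = foldr (\<circ>) ss id)"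

text \<open>The Bruhat order of the Coxeter system \<open>(\<langle>S\<rangle>, S)\<close>: the reflexive transitive closure of
  \<open>u < ut\<close> for \<open>t\<close> a conjugate of an element of \<open>S\<close> with \<open>\<ell>(u) < \<ell>(ut)\<close>.\<close>

definition conjugates :: "('v \<Rightarrow> 'v) set \<Rightarrow> ('v \<Rightarrow> 'v) set"
  where "conjugates S = {w \<circ> s \<circ> inv_into UNIV w | w s. w \<in> generated S \<and> s \<in> S}"

definition coxeter_bruhat_le :: "('v \<Rightarrow> 'v) set \<Rightarrow> ('v \<Rightarrow> 'v) \<Rightarrow> ('v \<Rightarrow> 'v) \<Rightarrow> bool"
  where "coxeter_bruhat_le S = (\<lambda>u v. u \<in> generated S \<and>
    (\<exists>t \<in> conjugates S. v = u \<circ> t) \<and> word_length S u < word_length S v)\<^sup>*\<^sup>*"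

definition bruhat_le ::
  "('x::ab_group_add, 'y, 'v::real_normed_vector) real_root_datum \<Rightarrow> ('v \<Rightarrow> 'v) \<Rightarrow> ('v \<Rightarrow> 'v) \<Rightarrow> bool"
  where "bruhat_le D x y \<longleftrightarrow>
    (\<exists>u \<in> affine_weyl D. \<exists>u' \<in> affine_weyl D. \<exists>\<tau> \<in> alcove_stabilizer D.
      x = u \<circ> \<tau> \<and> y = u' \<circ> \<tau> \<and> coxeter_bruhat_le (simple_reflections D) u u')"

text \<open>\<open>\<ell>(u\<tau>) = \<ell>(u)\<close>; the factor \<open>u\<close> is unique because \<open>X\<^sub>* \<rtimes> W\<close> is the semidirect product of
  the affine Weyl group and the stabilizer of the base alcove.\<close>

definition ext_length ::
  "('x::ab_group_add, 'y, 'v::real_normed_vector) real_root_datum \<Rightarrow> ('v \<Rightarrow> 'v) \<Rightarrow> nat"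
  where "ext_length D x = word_length (simple_reflections D)
    (THE u. u \<in> affine_weyl D \<and> (\<exists>\<tau> \<in> alcove_stabilizer D. x = u \<circ> \<tau>))"

definition min_coset_reps ::
  "('x::ab_group_add, 'y, 'v::real_normed_vector) real_root_datum \<Rightarrow> ('v \<Rightarrow> 'v) set \<Rightarrow> ('v \<Rightarrow> 'v) set"
  where "min_coset_reps D J = {y. \<exists>x \<in> ext_weyl D.
    let C = {x \<circ> w | w. w \<in> generated J}
    in y \<in> C \<and> (\<forall>z \<in> C. ext_length D y \<le> ext_length D z)}"

section \<open>Admissible sets\<close>

definition length_zero_part ::
  "('x::ab_group_add, 'y, 'v::real_normed_vector) real_root_datum \<Rightarrow> 'y \<Rightarrow> 'v \<Rightarrow> 'v"
  where "length_zero_part D \<mu> =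
    (THE \<tau>. \<tau> \<in> alcove_stabilizer D \<and> (\<exists>u \<in> affine_weyl D. transl D \<mu> = u \<circ> \<tau>))"

definition weyl_orbit ::
  "('x, 'y, 'v::real_normed_vector) real_root_datum \<Rightarrow> 'y \<Rightarrow> 'y set"
  where "weyl_orbit D \<mu> = {\<nu>. \<exists>w \<in> finite_weyl D. emb D \<nu> = w (emb D \<mu>)}"

definition Adm ::
  "('x::ab_group_add, 'y, 'v::real_normed_vector) real_root_datum \<Rightarrow> 'y \<Rightarrow> ('v \<Rightarrow> 'v) set"
  where "Adm D \<mu> = {x \<in> {u \<circ> length_zero_part D \<mu> | u. u \<in> affine_weyl D}.
    \<exists>\<nu> \<in> weyl_orbit D \<mu>. bruhat_le D x (transl D \<nu>)}"

definition Adm_parahoric ::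
  "('x::ab_group_add, 'y, 'v::real_normed_vector) real_root_datum \<Rightarrow> ('v \<Rightarrow> 'v) set \<Rightarrow> 'y
    \<Rightarrow> ('v \<Rightarrow> 'v) set"
  where "Adm_parahoric D J \<mu> =
    {u \<circ> x \<circ> v | u x v. u \<in> generated J \<and> x \<in> Adm D \<mu> \<and> v \<in> generated J}"

end

theory Submission
  imports Defs
begin

text \<open>Call \<open>x \<rightarrow> s\<^sub>f x\<close> an ascent if the affine root \<open>f\<close> is positive on the base alcove and on its image under
  \<open>x\<close>; the Bruhat order is generated by ascents. A simple reflection \<open>s\<close> permutes the positive affine
  roots other than its own, so multiplying both ends of an ascent by \<open>s\<close>, on either side, gives an
  ascent again unless the multiplication just interchanges the ends. Hence \<open>y \<le> t\<close> implies
  \<open>sy \<le> t\<close> or \<open>sy \<le> st\<close>, and also \<open>ys \<le> ts\<close> or \<open>y \<le> ts\<close>.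

  Let \<open>y \<le> t\<^sub>\<lambda>\<close> with \<open>\<lambda> \<in> W\<mu>\<close>. Then \<open>sy \<le> t\<^sub>\<lambda>\<close>, or else \<open>sy \<le> s t\<^sub>\<lambda>\<close> and so one of \<open>sys\<close>, \<open>sy\<close> is below
  \<open>s t\<^sub>\<lambda> s\<close>, again a translation by an element of \<open>W\<mu>\<close>. Inductively every coset \<open>u y W\<^sub>J\<close> with
  \<open>u \<in> W\<^sub>J\<close> and \<open>y\<close> admissible contains an admissible element, and its minimal element lies below all
  others, hence is admissible.\<close>

section \<open>Finite-dimensional normed spaces\<close>

text \<open>The definitions measure the Bruhat order by word length and by conjugates of simple
  reflections, whereas multiplication by \<open>s\<close> is controlled by signs of affine roots at
  a point \<open>p\<close> of the base alcove. Passing between the two takes most of the work: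
  exchange turns length comparisons into signs, and an element that stabilizes the alcove changes no
  sign at \<open>p\<close>.

  Two geometric facts feed this machinery. A simple reflection makes no other positive root negative
  because a wall is the affine hull of a piece of the closure of the alcove; this is where
  continuity on \<open>V\<close> enters, and with it the present preliminaries. Simple roots detect
  every departure from the alcove because a smallest subsystem of its defining inequalities consists
  of walls.

  Minimality of length in a coset is converted into ascents from \<open>z\<close> to
  \<open>z s\<close> for \<open>s\<close> in \<open>J\<close>; these local comparisons already place
  \<open>z\<close> below its whole coset.\<close>

lemma complete_span_insert:
  fixes S :: "'v::real_normed_vector set"
  assumes "complete (span S)"
  shows "complete (span (insert b S))"
proof (cases "b \<in> span S")
  case True
  then show ?thesis using assms by (simp add: span_redundant)
next
  case False
  \<comment> \<open>A complete subspace is closed, so \<open>b\<close> has positive distance from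
    it; this distance bounds the coefficient of \<open>b\<close>, which makes the coefficients of a
    Cauchy sequence Cauchy.\<close>
  define d where "d = infdist b (span S)"
  have d: "d > 0"
    unfolding d_def using assms False span_zero
    by (intro infdist_pos_not_in_closed complete_imp_closed) auto
  have bound: "\<bar>c\<bar> * d \<le> norm (c *\<^sub>R b + v)" if "v \<in> span S" for c v
  proof (cases "c = 0")
    case False
    have "- (inverse c *\<^sub>R v) \<in> span S" using that by (simp add: span_neg span_scale)
    then have "d \<le> norm (b - - (inverse c *\<^sub>R v))"
      unfolding d_def dist_norm[symmetric] by (rule infdist_le)
    then have "\<bar>c\<bar> * d \<le> norm (c *\<^sub>R (b + inverse c *\<^sub>R v))"
      by (simp add: mult_left_mono)
    with False show ?thesis by (simp add: scaleR_right_distrib)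
  qed simp
  show ?thesis
  proof (rule completeI)
    fix x :: "nat \<Rightarrow> 'v" assume x: "\<forall>n. x n \<in> span (insert b S)" and "Cauchy x"
    then obtain c where c: "\<And>n. x n - c n *\<^sub>R b \<in> span S"
      by (auto simp: span_breakdown_eq) metis
    define v where "v n = x n - c n *\<^sub>R b" for n
    have xcv: "x n = c n *\<^sub>R b + v n" for n by (simp add: v_def)
    have "Cauchy c"
    proof (rule CauchyI)
      fix e :: real assume "e > 0"
      with d have "e * d > 0" by simp
      then obtain M where M: "\<And>m n. m \<ge> M \<Longrightarrow> n \<ge> M \<Longrightarrow> norm (x m - x n) < e * d"
        using CauchyD[OF \<open>Cauchy x\<close>] by blast
      have "norm (c m - c n) < e" if "m \<ge> M" "n \<ge> M" for m n
      proof -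
        have "v m - v n \<in> span S" using c by (simp add: v_def span_diff)
        from bound[OF this, of "c m - c n"] have "\<bar>c m - c n\<bar> * d \<le> norm (x m - x n)"
          by (simp add: xcv algebra_simps)
        then have "\<bar>c m - c n\<bar> * d < e * d" using M[OF that] by linarith
        then show ?thesis using d by simp
      qed
      then show "\<exists>M. \<forall>m\<ge>M. \<forall>n\<ge>M. norm (c m - c n) < e" by blast
    qed
    then obtain l where l: "c \<longlonglongrightarrow> l" using Cauchy_convergent_iff convergent_def by blast
    then have "(\<lambda>n. c n *\<^sub>R b) \<longlonglongrightarrow> l *\<^sub>R b" by (intro tendsto_intros)
    moreover have "Cauchy v"
    proof (rule CauchyI)
      fix e :: real assume "e > 0"
      have "Cauchy (\<lambda>n. c n *\<^sub>R b)"
        using calculation LIMSEQ_imp_Cauchy by blast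
      then obtain M where M: "\<And>m n. m \<ge> M \<Longrightarrow> n \<ge> M \<Longrightarrow> norm (c m *\<^sub>R b - c n *\<^sub>R b) < e / 2"
        using CauchyD[of "\<lambda>n. c n *\<^sub>R b" "e / 2"] \<open>e > 0\<close> by auto
      obtain N where N: "\<And>m n. m \<ge> N \<Longrightarrow> n \<ge> N \<Longrightarrow> norm (x m - x n) < e / 2"
        using CauchyD[OF \<open>Cauchy x\<close>, of "e / 2"] \<open>e > 0\<close> by auto
      have "norm (v m - v n) < e" if "m \<ge> max M N" "n \<ge> max M N" for m n
      proof -
        have "v m - v n = (x m - x n) - (c m *\<^sub>R b - c n *\<^sub>R b)" by (simp add: v_def)
        then have "norm (v m - v n) \<le> norm (x m - x n) + norm (c m *\<^sub>R b - c n *\<^sub>R b)"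
          using norm_triangle_ineq4 by metis
        also have "\<dots> < e" using M[of m n] N[of m n] that by simp
        finally show ?thesis .
      qed
      then show "\<exists>M. \<forall>m\<ge>M. \<forall>n\<ge>M. norm (v m - v n) < e" by blast
    qed
    then obtain u where "u \<in> span S" "v \<longlonglongrightarrow> u"
      using completeE[OF assms, of v] c by (auto simp: v_def)
    moreover have "l *\<^sub>R b + u \<in> span (insert b S)"
      using \<open>u \<in> span S\<close> by (auto simp: span_breakdown_eq intro: exI[of _ l])
    moreover have "x = (\<lambda>n. c n *\<^sub>R b + v n)" by (simp add: v_def)
    ultimately show "\<exists>y\<in>span (insert b S). x \<longlonglongrightarrow> y"
      using tendsto_add by blast
  qed
qed

lemma complete_span_finite:
  fixes B :: "'v::real_normed_vector set"
  assumes "finite B"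
  shows "complete (span B)"
  using assms
proof (induction B rule: finite_induct)
  case empty
  then show ?case by (simp add: compact_imp_complete)
next
  case (insert b B)
  then show ?case by (intro complete_span_insert)
qed

text \<open>The norm is arbitrary, so continuity has to come from finite dimension: the kernel is
  spanned by a finite set, hence closed, and a vector with value 1 has positive distance
  \<open>d\<close> from it. Then \<open>1 / d\<close> bounds the functional.\<close>

lemma continuous_on_linear_functional:
  fixes B :: "'v::real_normed_vector set" and f :: "'v \<Rightarrow> real"
  assumes B: "finite B" "span B = UNIV" and f: "linear f"
  shows "continuous_on UNIV f"
proof (cases "\<exists>e. f e \<noteq> 0")
  case False
  then have "f = (\<lambda>x. 0)" by auto
  then show ?thesis by simp
next
  case True
  then obtain e' where "f e' \<noteq> 0" by blast
  define e where "e = inverse (f e') *\<^sub>R e'"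
  have e: "f e = 1" using \<open>f e' \<noteq> 0\<close> by (simp add: e_def linear_scale[OF f])
  let ?K = "{x. f x = 0}"
  have "subspace ?K" using f by (rule linear_subspace_kernel)
  obtain C where C: "C \<subseteq> ?K" "independent C" "?K \<subseteq> span C"
    using maximal_independent_subset by blast
  then have "finite C" using real_vector.independent_span_bound[OF B(1), of C] B(2) by auto
  moreover have "span C = ?K"
    using C \<open>subspace ?K\<close> by (simp add: span_subspace)
  ultimately have "closed ?K"
    using complete_span_finite[of C] complete_imp_closed by auto
  define d where "d = infdist e ?K"
  have d: "d > 0"
    unfolding d_def using \<open>closed ?K\<close> e linear_0[OF f]
    by (intro infdist_pos_not_in_closed) auto
  have "norm (f x) \<le> norm x * inverse d" for x
  proof (cases "f x = 0")
    case False
    \<comment> \<open>Thus \<open>x / f x\<close> is \<open>e\<close> minus a kernel vector, so its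
      norm is at least \<open>d\<close>.\<close>
    have "e - inverse (f x) *\<^sub>R x \<in> ?K"
      using False e by (simp add: linear_diff[OF f] linear_scale[OF f])
    then have "d \<le> dist e (e - inverse (f x) *\<^sub>R x)"
      unfolding d_def by (rule infdist_le)
    then have "d \<le> inverse \<bar>f x\<bar> * norm x" by (simp add: dist_norm)
    then show ?thesis using False d by (simp add: field_simps)
  qed (use d in auto)
  then have "bounded_linear f"
    using f by (intro bounded_linear_intro[where K = "inverse d"]) (auto simp: linear_add linear_scale)
  then show ?thesis by (rule linear_continuous_on)
qed

section \<open>Groups generated by involutions\<close>

lemma mem_BijGroup_UNIV: "f \<in> carrier (BijGroup UNIV) \<longleftrightarrow> bij f"
  by (simp add: BijGroup_def Bij_def)

lemma mult_BijGroup_UNIV: "bij f \<Longrightarrow> bij g \<Longrightarrow> f \<otimes>\<^bsub>BijGroup UNIV\<^esub> g = f \<circ> g"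
  by (auto simp: BijGroup_def Bij_def compose_def)

lemma one_BijGroup_UNIV: "\<one>\<^bsub>BijGroup UNIV\<^esub> = id"
  by (auto simp: BijGroup_def)

definition word_prod :: "('v \<Rightarrow> 'v) list \<Rightarrow> 'v \<Rightarrow> 'v"
  where "word_prod ss = foldr (\<circ>) ss id"

lemma word_prod_Nil: "word_prod [] = id"
  by (simp add: word_prod_def fun_eq_iff)

lemma word_prod_Cons: "word_prod (s # ss) = s \<circ> word_prod ss"
  by (simp add: word_prod_def)

lemma word_prod_append: "word_prod (xs @ ys) = word_prod xs \<circ> word_prod ys"
  by (induction xs) (simp_all add: comp_assoc word_prod_Nil word_prod_Cons)

locale involutions =
  fixes S :: "('v \<Rightarrow> 'v) set"
  assumes invol: "s \<in> S \<Longrightarrow> s \<circ> s = id"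
begin

lemma subset: "J \<subseteq> S \<Longrightarrow> involutions J"
  using invol by (auto simp: involutions_def)

lemma bij_involution: "s \<in> S \<Longrightarrow> bij s"
  using invol o_bij by blast

lemma bij_word: "set ss \<subseteq> S \<Longrightarrow> bij (word_prod ss)"
  by (induction ss) (simp_all add: word_prod_Nil word_prod_Cons bij_comp bij_involution)

text \<open>The inverse of a generator is the generator itself, so closure under inverses adds
  nothing to the products of words.\<close>

lemma generated_iff_word: "w \<in> generated S \<longleftrightarrow> (\<exists>ss. set ss \<subseteq> S \<and> w = word_prod ss)"
proof
  assume "w \<in> generated S"
  then have "w \<in> generate (BijGroup UNIV) S" by (simp add: generated_def)
  then show "\<exists>ss. set ss \<subseteq> S \<and> w = word_prod ss"
  proof (induction rule: generate.induct)
    case one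
    then show ?case by (intro exI[of _ "[]"]) (simp add: one_BijGroup_UNIV word_prod_Nil)
  next
    case (incl h)
    then show ?case by (intro exI[of _ "[h]"]) (simp add: word_prod_Nil word_prod_Cons)
  next
    case (inv h)
    interpret group "BijGroup (UNIV :: 'v set)" by (rule group_BijGroup)
    have "h \<otimes>\<^bsub>BijGroup UNIV\<^esub> h = \<one>\<^bsub>BijGroup UNIV\<^esub>"
      using inv by (simp add: mult_BijGroup_UNIV bij_involution invol one_BijGroup_UNIV)
    then have "inv\<^bsub>BijGroup UNIV\<^esub> h = h"
      using inv by (intro inv_equality) (auto simp: mem_BijGroup_UNIV bij_involution)
    then show ?case using inv by (intro exI[of _ "[h]"]) (simp add: word_prod_Nil word_prod_Cons)
  next
    case (eng h1 h2)
    then obtain s1 s2 where *: "set s1 \<subseteq> S" "set s2 \<subseteq> S"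
      "h1 = word_prod s1" "h2 = word_prod s2" by blast
    then have "h1 \<otimes>\<^bsub>BijGroup UNIV\<^esub> h2 = word_prod (s1 @ s2)"
      by (simp only: mult_BijGroup_UNIV bij_word word_prod_append)
    then show ?case using * by (metis Un_least set_append)
  qed
next
  assume "\<exists>ss. set ss \<subseteq> S \<and> w = word_prod ss"
  then obtain ss where "set ss \<subseteq> S" "w = word_prod ss" by blast
  then show "w \<in> generated S"
  proof (induction ss arbitrary: w)
    case Nil
    then have "w = id" by (simp only: word_prod_Nil)
    then show ?case using generate.one[of "BijGroup UNIV" S]
      by (simp only: generated_def one_BijGroup_UNIV)
  next
    case (Cons s ss)
    then have "s \<otimes>\<^bsub>BijGroup UNIV\<^esub> word_prod ss \<in> generated S"
      unfolding generated_def by (auto intro: generate.eng generate.incl)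
    moreover have "w = s \<otimes>\<^bsub>BijGroup UNIV\<^esub> word_prod ss"
      unfolding Cons.prems(2) word_prod_Cons
      using Cons.prems(1) by (intro mult_BijGroup_UNIV[symmetric] bij_involution bij_word) auto
    ultimately show ?case by simp
  qed
qed

lemma id_generated: "id \<in> generated S"
  unfolding generated_iff_word by (rule exI[of _ "[]"]) (simp add: word_prod_Nil)

lemma generator_generated: "s \<in> S \<Longrightarrow> s \<in> generated S"
  unfolding generated_iff_word by (rule exI[of _ "[s]"]) (simp add: word_prod_Nil word_prod_Cons)

lemma comp_generated:
  assumes "u \<in> generated S" "w \<in> generated S" shows "u \<circ> w \<in> generated S"
proof -
  obtain s1 s2 where "set s1 \<subseteq> S" "set s2 \<subseteq> S" "u = word_prod s1" "w = word_prod s2"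
    using assms unfolding generated_iff_word by blast
  then show ?thesis
    unfolding generated_iff_word by (intro exI[of _ "s1 @ s2"]) (simp add: word_prod_append)
qed

lemma generated_induct [consumes 1, case_names id comp]:
  assumes "w \<in> generated S" "P id"
    and step: "\<And>s w. s \<in> S \<Longrightarrow> w \<in> generated S \<Longrightarrow> P w \<Longrightarrow> P (s \<circ> w)"
  shows "P w"
proof -
  have "P (word_prod ss)" if "set ss \<subseteq> S" for ss
    using that
  proof (induction ss)
    case (Cons s ss)
    then have "word_prod ss \<in> generated S" "s \<in> S" "P (word_prod ss)"
      unfolding generated_iff_word by (simp_all, blast)
    then show ?case unfolding word_prod_Cons by (intro step)
  qed (simp add: assms(2) word_prod_Nil)
  then show ?thesis using assms(1) unfolding generated_iff_word by blast
qed

lemma generated_induct_right [consumes 1, case_names id comp]: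
  assumes "w \<in> generated S" "P id"
    and step: "\<And>w s. w \<in> generated S \<Longrightarrow> s \<in> S \<Longrightarrow> P w \<Longrightarrow> P (w \<circ> s)"
  shows "P w"
proof -
  have "P (word_prod ss)" if "set ss \<subseteq> S" for ss
    using that
  proof (induction ss rule: rev_induct)
    case (snoc s ss)
    then have "word_prod ss \<in> generated S" "s \<in> S" "P (word_prod ss)"
      unfolding generated_iff_word by (simp_all, blast)
    then show ?case unfolding word_prod_append word_prod_Cons word_prod_Nil comp_id by (intro step)
  qed (simp add: assms(2) word_prod_Nil)
  then show ?thesis using assms(1) unfolding generated_iff_word by blast
qed

lemma inv_generated: "w \<in> generated S \<Longrightarrow> \<exists>w'\<in>generated S. w' \<circ> w = id \<and> w \<circ> w' = id"
proof (induction rule: generated_induct)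
  case id
  show ?case by (intro bexI[OF _ id_generated]) simp
next
  case (comp s w)
  then obtain w' where w': "w' \<in> generated S" "w' \<circ> w = id" "w \<circ> w' = id" by blast
  have "(w' \<circ> s) \<circ> (s \<circ> w) = id" "(s \<circ> w) \<circ> (w' \<circ> s) = id"
    using w' invol[OF comp(1)] by (simp_all add: fun_eq_iff)
  moreover have "w' \<circ> s \<in> generated S" using w' comp(1) comp_generated generator_generated by blast
  ultimately show ?case by blast
qed

lemma generated_mono: "J \<subseteq> S \<Longrightarrow> generated J \<subseteq> generated S"
  by (force simp: involutions.generated_iff_word[OF subset] generated_iff_word)

lemma word_length_le: "set ss \<subseteq> S \<Longrightarrow> word_length S (word_prod ss) \<le> length ss"
  unfolding word_length_def word_prod_def by (rule Least_le) blast

lemma reduced_word: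
  assumes "w \<in> generated S"
  obtains ss where "set ss \<subseteq> S" "w = word_prod ss" "length ss = word_length S w"
proof -
  have "\<exists>n ss. length ss = n \<and> set ss \<subseteq> S \<and> w = word_prod ss"
    using assms unfolding generated_iff_word by blast
  then have "\<exists>ss. length ss = word_length S w \<and> set ss \<subseteq> S \<and> w = word_prod ss"
    unfolding word_length_def word_prod_def by (rule LeastI_ex)
  then show thesis using that by blast
qed

end

section \<open>Reflection groups acting on roots\<close>

lemma comp_cancel_left: "g \<circ> h = id \<Longrightarrow> g \<circ> (h \<circ> x) = x"
  by (simp add: fun_eq_iff)

lemma comp_cancel_right: "g \<circ> h = id \<Longrightarrow> x \<circ> g \<circ> h = x"
  by (simp add: comp_assoc)

text \<open>Intended model: \<open>G\<close> is the extended affine Weyl group, \<open>\<Phi>\<close> the affine roots and \<open>p\<close> a point of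
  the base alcove, so that \<open>f p > 0\<close> singles out the positive affine roots \<open>f\<close>.\<close>

locale root_arrangement =
  fixes G :: "('v \<Rightarrow> 'v) set" and \<Phi> :: "('v \<Rightarrow> real) set"
    and refl :: "('v \<Rightarrow> real) \<Rightarrow> 'v \<Rightarrow> 'v" and \<Delta> :: "('v \<Rightarrow> real) set" and p :: 'v
  assumes id_mem: "id \<in> G"
    and comp_mem: "g \<in> G \<Longrightarrow> h \<in> G \<Longrightarrow> g \<circ> h \<in> G"
    and inv_mem: "g \<in> G \<Longrightarrow> \<exists>h\<in>G. h \<circ> g = id \<and> g \<circ> h = id"
    and root_comp: "f \<in> \<Phi> \<Longrightarrow> g \<in> G \<Longrightarrow> f \<circ> g \<in> \<Phi>"
    and root_minus: "f \<in> \<Phi> \<Longrightarrow> - f \<in> \<Phi>"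
    and root_nonzero: "f \<in> \<Phi> \<Longrightarrow> f p \<noteq> 0"
    and refl_mem: "f \<in> \<Phi> \<Longrightarrow> refl f \<in> G"
    and refl_refl: "f \<in> \<Phi> \<Longrightarrow> refl f (refl f x) = x"
    and root_refl: "f \<in> \<Phi> \<Longrightarrow> f (refl f x) = - f x"
    and refl_minus: "f \<in> \<Phi> \<Longrightarrow> refl (- f) = refl f"
    and refl_conj: "f \<in> \<Phi> \<Longrightarrow> g \<in> G \<Longrightarrow> g (refl (f \<circ> g) x) = refl f (g x)"
    and finite_inversions: "g \<in> G \<Longrightarrow> finite {f \<in> \<Phi>. f p > 0 \<and> f (g p) < 0}"
    and simple_root: "a \<in> \<Delta> \<Longrightarrow> a \<in> \<Phi>"
    and simple_pos: "a \<in> \<Delta> \<Longrightarrow> a p > 0"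
    and simple_refl_pos: "a \<in> \<Delta> \<Longrightarrow> f \<in> \<Phi> \<Longrightarrow> f p > 0 \<Longrightarrow> f \<noteq> a \<Longrightarrow> f (refl a p) > 0"
    and simple_separates: "g \<in> G \<Longrightarrow> f \<in> \<Phi> \<Longrightarrow> f p > 0 \<Longrightarrow> f (g p) < 0 \<Longrightarrow> \<exists>a\<in>\<Delta>. a (g p) < 0"
begin

section \<open>Signs at the base point and conjugation of reflections\<close>

abbreviation S :: "('v \<Rightarrow> 'v) set" where "S \<equiv> refl ` \<Delta>"

sublocale involutions S
  by unfold_locales (auto simp: fun_eq_iff refl_refl simple_root)

lemma generated_subset: "generated S \<subseteq> G"
proof
  fix w assume "w \<in> generated S"
  then show "w \<in> G"
    by (induction rule: generated_induct) (blast intro: id_mem comp_mem refl_mem simple_root)+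
qed

lemma refl_conj_comp: "f \<in> \<Phi> \<Longrightarrow> g \<in> G \<Longrightarrow> f \<circ> g = h \<Longrightarrow> refl f \<circ> g = g \<circ> refl h"
  using refl_conj by (metis (no_types) comp_apply ext)

lemma root_sign: "f \<in> \<Phi> \<Longrightarrow> g \<in> G \<Longrightarrow> f (g p) \<noteq> 0"
  using root_nonzero[OF root_comp] by simp

text \<open>The elements of length zero, described by signs at \<open>p\<close>. For the extended
  affine Weyl group this is the alcove stabilizer, because the signs at one point determine the
  alcove.\<close>

definition stab :: "('v \<Rightarrow> 'v) set"
  where "stab = {\<tau> \<in> G. \<forall>f\<in>\<Phi>. f p > 0 \<longrightarrow> f (\<tau> p) > 0}"

lemma stab_mem: "\<tau> \<in> stab \<Longrightarrow> \<tau> \<in> G"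
  by (simp add: stab_def)

text \<open>The definition of \<open>stab\<close> gives one direction; applied to
  \<open>- f\<close>, with \<open>f p\<close> nonzero, it gives the other.\<close>

lemma stab_sign:
  assumes "\<tau> \<in> stab" "f \<in> \<Phi>" shows "f (\<tau> p) > 0 \<longleftrightarrow> f p > 0"
proof -
  have "(- f) p > 0 \<longrightarrow> (- f) (\<tau> p) > 0" "f p > 0 \<longrightarrow> f (\<tau> p) > 0"
    using assms root_minus[OF assms(2)] unfolding stab_def by blast+
  then show ?thesis using root_nonzero[OF assms(2)] by (auto simp: linorder_neq_iff)
qed

lemma stab_sign_comp: "\<tau> \<in> stab \<Longrightarrow> f \<in> \<Phi> \<Longrightarrow> g \<in> G \<Longrightarrow> f (g (\<tau> p)) > 0 \<longleftrightarrow> f (g p) > 0"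
  using stab_sign[OF _ root_comp] by simp

text \<open>Conjugating \<open>refl h\<close> by \<open>g\<close> gives the reflection in
  \<open>h\<close> composed with the inverse of \<open>g\<close>; since \<open>f\<close> and
  \<open>- f\<close> have the same reflection, the root can be chosen positive. This moves
  reflections from the right of \<open>g\<close> to its left.\<close>

lemma root_translate:
  assumes "g \<in> G" "h \<in> \<Phi>"
  obtains f where "f \<in> \<Phi>" "f p > 0" "refl f \<circ> g = g \<circ> refl h"
proof -
  obtain g' where g': "g' \<in> G" "g' \<circ> g = id" "g \<circ> g' = id" using inv_mem assms(1) by blast
  let ?f = "h \<circ> g'"
  have f: "?f \<in> \<Phi>" using root_comp assms(2) g'(1) by blast
  have "?f \<circ> g = h" unfolding comp_assoc g' by simp
  then have eq: "refl ?f \<circ> g = g \<circ> refl h"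
    by (rule refl_conj_comp[OF f assms(1)])
  show thesis
  proof (cases "?f p > 0")
    case False
    then have "(- ?f) p > 0" using root_nonzero[OF f] by simp
    then show thesis using that[OF root_minus[OF f]] refl_minus[OF f] eq by metis
  qed (use f eq that in blast)
qed

subsection \<open>The Bruhat order\<close>

text \<open>For the extended affine Weyl group, ascents generate the Bruhat order: \<open>f p > 0\<close> and
  \<open>f (x p) > 0\<close> say that the hyperplane of \<open>f\<close> does not separate the base alcove from its image
  under \<open>x\<close>.\<close>

definition ascent :: "('v \<Rightarrow> 'v) \<Rightarrow> ('v \<Rightarrow> 'v) \<Rightarrow> bool"
  where "ascent x y \<longleftrightarrow> x \<in> G \<and> (\<exists>f\<in>\<Phi>. f p > 0 \<and> f (x p) > 0 \<and> y = refl f \<circ> x)"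

text \<open>The witnessing root changes from \<open>f\<close> to \<open>f \<circ> s\<close>. It
  stays positive unless \<open>f\<close> is the root of \<open>s\<close>, and in that case
  \<open>s \<circ> x\<close> is the upper end itself.\<close>

lemma ascent_left:
  assumes "ascent x y" "s \<in> S" shows "s \<circ> x = y \<or> ascent (s \<circ> x) (s \<circ> y)"
proof -
  obtain f where x: "x \<in> G" and f: "f \<in> \<Phi>" "f p > 0" "f (x p) > 0" and y: "y = refl f \<circ> x"
    using assms(1) unfolding ascent_def by blast
  obtain a where a: "a \<in> \<Delta>" and s: "s = refl a" using assms(2) by blast
  have sG: "s \<in> G" and ss: "\<And>z. s (s z) = z"
    using a s refl_mem refl_refl simple_root by blast+
  show ?thesis
  proof (cases "f = a")
    case True
    then show ?thesis using y s by blast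
  next
    case False
    have "f \<circ> s \<in> \<Phi>" using root_comp f sG by blast
    moreover have "(f \<circ> s) p > 0" using simple_refl_pos[OF a f(1,2) False] s by simp
    moreover have "(f \<circ> s) ((s \<circ> x) p) > 0" using f ss by simp
    moreover have "s \<circ> y = refl (f \<circ> s) \<circ> (s \<circ> x)"
    proof
      fix z
      have "s (refl (f \<circ> s) (s (x z))) = refl f (x z)"
        using refl_conj[OF f(1) sG] ss by simp
      then show "(s \<circ> y) z = (refl (f \<circ> s) \<circ> (s \<circ> x)) z" using y ss by (metis comp_apply)
    qed
    ultimately show ?thesis using comp_mem[OF sG x] unfolding ascent_def by blast
  qed
qed

text \<open>Here the witness \<open>f\<close> stays. Its sign at \<open>x (s p)\<close> is that of
  the positive root \<open>f \<circ> x\<close> at \<open>s p\<close>, which can only flip if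
  \<open>f \<circ> x\<close> is the root of \<open>s\<close>.\<close>

lemma ascent_right:
  assumes "ascent x y" "s \<in> S" shows "x \<circ> s = y \<or> ascent (x \<circ> s) (y \<circ> s)"
proof -
  obtain f where x: "x \<in> G" and f: "f \<in> \<Phi>" "f p > 0" "f (x p) > 0" and y: "y = refl f \<circ> x"
    using assms(1) unfolding ascent_def by blast
  obtain a where a: "a \<in> \<Delta>" and s: "s = refl a" using assms(2) by blast
  have sG: "s \<in> G" using a s refl_mem simple_root by blast
  show ?thesis
  proof (cases "f \<circ> x = a")
    case True
    then show ?thesis using refl_conj_comp[OF f(1) x] y s by metis
  next
    case False
    have "f \<circ> x \<in> \<Phi>" "(f \<circ> x) p > 0" using root_comp f x by simp_all
    then have "(f \<circ> x) (s p) > 0" using simple_refl_pos[OF a _ _ False] s by blast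
    then have "f ((x \<circ> s) p) > 0" by simp
    moreover have "y \<circ> s = refl f \<circ> (x \<circ> s)" unfolding y by (rule comp_assoc)
    ultimately show ?thesis using comp_mem[OF x sG] f unfolding ascent_def by blast
  qed
qed

definition below :: "('v \<Rightarrow> 'v) \<Rightarrow> ('v \<Rightarrow> 'v) \<Rightarrow> bool"
  where "below = ascent\<^sup>*\<^sup>*"

lemma below_refl: "below x x"
  by (simp add: below_def)

lemma below_trans: "below x y \<Longrightarrow> below y z \<Longrightarrow> below x z"
  unfolding below_def by (rule rtranclp_trans)

lemma ascent_below: "ascent x y \<Longrightarrow> below x y"
  unfolding below_def by (rule r_into_rtranclp)

text \<open>The chain grows at its upper end, because it is the upper element that may stay or move.
  If the new step collapses, \<open>s \<circ> y\<close> equals \<open>z\<close>, and the second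
  alternative for \<open>y\<close> becomes the first one for \<open>z\<close>.\<close>

lemma below_left:
  assumes "below x y" "s \<in> S" shows "below (s \<circ> x) y \<or> below (s \<circ> x) (s \<circ> y)"
  using assms(1) unfolding below_def
proof (induction rule: rtranclp_induct)
  case (step y z)
  then show ?case
    using ascent_left[OF step(2) assms(2)] by (metis rtranclp.rtrancl_into_rtrancl)
qed simp

lemma below_right:
  assumes "below x y" "s \<in> S" shows "below (x \<circ> s) (y \<circ> s) \<or> below x (y \<circ> s)"
  using assms(1) unfolding below_def
proof (induction rule: converse_rtranclp_induct)
  case (step x x')
  \<comment> \<open>In a collapsed step the induction hypothesis on \<open>x' \<circ> s\<close> is a
    statement about \<open>x\<close>. The chain grows at its lower end, since here the lower element
    may stay.\<close>
  have "x' \<circ> s = x" if "x \<circ> s = x'"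
    unfolding that[symmetric] comp_assoc invol[OF assms(2)] by simp
  then show ?case
    using ascent_right[OF step(1) assms(2)] step by (metis converse_rtranclp_into_rtranclp)
qed simp

text \<open>\<open>P\<close> stands for the translations by the orbit of \<open>\<mu>\<close>; all
  that is asked of them is stability under conjugation by \<open>J\<close>.\<close>

lemma coset_meets_below:
  assumes J: "J \<subseteq> S" and P: "\<And>s t. s \<in> J \<Longrightarrow> t \<in> P \<Longrightarrow> s \<circ> t \<circ> s \<in> P"
    and u: "u \<in> generated J" and y: "t \<in> P" "below y t"
  obtains v t' where "v \<in> generated J" "t' \<in> P" "below (u \<circ> y \<circ> v) t'"
proof -
  interpret J: involutions J using J by (rule subset)
  have "\<exists>v\<in>generated J. \<exists>t'\<in>P. below (u \<circ> y \<circ> v) t'"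
    using u
  proof (induction rule: J.generated_induct)
    case id
    then show ?case using y by (intro bexI[OF _ J.id_generated] bexI[OF _ y(1)]) simp
  next
    case (comp s u)
    then obtain v t' where v: "v \<in> generated J" "t' \<in> P" "below (u \<circ> y \<circ> v) t'" by blast
    have s: "s \<in> S" using comp(1) J by blast
    have vs: "v \<circ> s \<in> generated J" using v(1) comp(1) J.comp_generated J.generator_generated by blast
    have sts: "s \<circ> t' \<circ> s \<in> P" using P comp(1) v(2) by blast
    have eq: "s \<circ> u \<circ> y \<circ> v = s \<circ> (u \<circ> y \<circ> v)" "s \<circ> u \<circ> y \<circ> (v \<circ> s) = s \<circ> (u \<circ> y \<circ> v) \<circ> s"
      by (simp_all add: comp_assoc)
    consider "below (s \<circ> (u \<circ> y \<circ> v)) t'" | "below (s \<circ> (u \<circ> y \<circ> v)) (s \<circ> t')"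
      using below_left[OF v(3) s] by blast
    then show ?case
    proof cases
      case 1
      then show ?thesis using v eq by metis
    next
      case 2
      \<comment> \<open>Since \<open>s \<circ> t'\<close> need not lie in \<open>P\<close>, a right
        factor \<open>s\<close> completes the conjugation; the lower element either absorbs it,
        replacing \<open>v\<close> by \<open>v \<circ> s\<close>, or keeps \<open>v\<close>.\<close>
      then show ?thesis using below_right[OF 2 s] v(1) vs sts eq by metis
    qed
  qed
  then show thesis using that by blast
qed

text \<open>When a letter \<open>s\<close> is appended to \<open>v\<close>, either \<open>z\<close>
  is below \<open>z \<circ> v \<circ> s\<close> at once, or \<open>z \<circ> s\<close> is, and
  \<open>z\<close> is below \<open>z \<circ> s\<close> by hypothesis.\<close>

lemma minimal_below_coset:
  assumes J: "J \<subseteq> S" and z: "\<And>s. s \<in> J \<Longrightarrow> ascent z (z \<circ> s)" and v: "v \<in> generated J"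
  shows "below z (z \<circ> v)"
proof -
  interpret J: involutions J using J by (rule subset)
  show ?thesis using v
  proof (induction rule: J.generated_induct_right)
    case id
    then show ?case by (simp add: below_refl)
  next
    case (comp v s)
    have "below (z \<circ> s) (z \<circ> v \<circ> s) \<or> below z (z \<circ> v \<circ> s)"
      using below_right comp J by blast
    then show ?case
      using ascent_below[OF z[OF comp(2)]] below_trans by (metis comp_assoc)
  qed
qed

subsection \<open>Comparison with word length\<close>

text \<open>Along the prefixes of the word the sign of \<open>f\<close> goes from positive to
  negative. At the letter where it flips, the prefix transports \<open>f\<close> to the simple root
  of that letter, so \<open>refl f\<close> deletes it.\<close>

lemma exchange:
  assumes "set ss \<subseteq> S" "f \<in> \<Phi>" "f p > 0" "f (word_prod ss p) < 0"
  shows "\<exists>ts. set ts \<subseteq> S \<and> length ts < length ss \<and> refl f \<circ> word_prod ss = word_prod ts"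
  using assms(1,4)
proof (induction ss rule: rev_induct)
  case Nil
  then show ?case using assms(3) by (simp add: word_prod_Nil)
next
  case (snoc s ss)
  let ?w = "word_prod ss"
  have w: "?w \<in> G" using snoc.prems generated_subset generated_iff_word[of ?w] by auto
  have ws: "word_prod (ss @ [s]) = ?w \<circ> s"
    by (simp only: word_prod_append word_prod_Cons word_prod_Nil comp_id)
  obtain a where a: "a \<in> \<Delta>" and s: "s = refl a" using snoc.prems(1) by auto
  show ?case
  proof (cases "f (?w p) < 0")
    case True
    then obtain ts where ts: "set ts \<subseteq> S" "length ts < length ss" "refl f \<circ> ?w = word_prod ts"
      using snoc.IH snoc.prems(1) by (metis Un_subset_iff set_append)
    have "refl f \<circ> word_prod (ss @ [s]) = word_prod (ts @ [s])"
      using ts(3) by (simp only: word_prod_append comp_assoc[symmetric])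
    then show ?thesis using ts snoc.prems(1) by (intro exI[of _ "ts @ [s]"]) simp
  next
    case False
    then have "f (?w p) > 0" using root_sign[OF assms(2) w] by simp
    moreover have "f (?w (s p)) < 0" using snoc.prems(2) ws by simp
    ultimately have "f \<circ> ?w = a"
      using simple_refl_pos[OF a root_comp[OF assms(2) w]] s
      by (metis comp_apply less_asym)
    then have "refl f (?w (s z)) = ?w z" for z
      using refl_conj[OF assms(2) w, of "s z"] refl_refl[OF simple_root[OF a]] s by simp
    then have "refl f \<circ> word_prod (ss @ [s]) = ?w" unfolding ws by (simp add: fun_eq_iff)
    then show ?thesis using snoc.prems(1) by (intro exI[of _ ss]) simp
  qed
qed

lemma word_length_refl_less:
  assumes "w \<in> generated S" "f \<in> \<Phi>" "f p > 0" "f (w p) < 0"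
  shows "word_length S (refl f \<circ> w) < word_length S w"
proof -
  obtain ss where ss: "set ss \<subseteq> S" "w = word_prod ss" "length ss = word_length S w"
    using reduced_word[OF assms(1)] .
  then obtain ts where "set ts \<subseteq> S" "length ts < length ss" "refl f \<circ> w = word_prod ts"
    using exchange[OF ss(1) assms(2,3)] assms(4) by blast
  then show ?thesis using word_length_le[of ts] ss(3) by simp
qed

text \<open>The prefix just before the sign flip is the required \<open>v\<close>. The purpose is to
  see that every reflection is conjugate to a simple one.\<close>

lemma inversion_conj_simple:
  assumes "w \<in> generated S" "f \<in> \<Phi>" "f p > 0" "f (w p) < 0"
  shows "\<exists>v\<in>generated S. f \<circ> v \<in> \<Delta>"
  using assms(1,4)
proof (induction rule: generated_induct_right)
  case id
  then show ?case using assms(3) by simp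
next
  case (comp w s)
  have w: "w \<in> G" using comp(1) generated_subset by blast
  obtain a where a: "a \<in> \<Delta>" "s = refl a" using comp(2) by blast
  show ?case
  proof (cases "f (w p) < 0")
    case False
    then have "f (w p) > 0" using root_sign[OF assms(2) w] by simp
    moreover have "f (w (s p)) < 0" using comp by simp
    ultimately have "f \<circ> w = a"
      using simple_refl_pos[OF a(1) root_comp[OF assms(2) w]] a(2) by (metis comp_apply less_asym)
    then show ?thesis using a comp(1) by blast
  qed (use comp in blast)
qed

text \<open>A simple root that is negative at \<open>g p\<close> gives a simple reflection whose
  left multiplication lowers the number of inversions; an element without inversions lies in
  \<open>stab\<close>.\<close>

lemma decompose:
  assumes "g \<in> G"
  shows "\<exists>w\<in>generated S. \<exists>\<tau>\<in>stab. g = w \<circ> \<tau>"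
  using assms
proof (induction "card {f \<in> \<Phi>. f p > 0 \<and> f (g p) < 0}" arbitrary: g rule: less_induct)
  case less
  let ?N = "\<lambda>g. {f \<in> \<Phi>. f p > 0 \<and> f (g p) < 0}"
  show ?case
  proof (cases "?N g = {}")
    case True
    then have "g \<in> stab"
      using less.prems root_sign[OF _ less.prems] unfolding stab_def
      by (auto simp: linorder_neq_iff)
    then show ?thesis by (intro bexI[OF _ id_generated] bexI[of _ g]) simp_all
  next
    case False
    then obtain a where a: "a \<in> \<Delta>" "a (g p) < 0" using simple_separates[OF less.prems] by blast
    let ?s = "refl a"
    have s: "?s \<in> G" "\<And>x. ?s (?s x) = x" "\<And>x. a (?s x) = - a x"
      using a refl_mem refl_refl root_refl simple_root by blast+
    have sg: "?s \<circ> g \<in> G" using comp_mem s less.prems by blast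
    \<comment> \<open>Precomposition with \<open>?s\<close> embeds the inversions of
      \<open>?s \<circ> g\<close> into those of \<open>g\<close>. The root \<open>a\<close> is
      missed: it could only come from \<open>- a\<close>, which is not positive.\<close>
    have "(\<lambda>f. f \<circ> ?s) ` ?N (?s \<circ> g) \<subseteq> ?N g - {a}"
    proof
      fix h assume "h \<in> (\<lambda>f. f \<circ> ?s) ` ?N (?s \<circ> g)"
      then obtain f where f: "h = f \<circ> ?s" "f \<in> \<Phi>" "f p > 0" "f (?s (g p)) < 0" by auto
      have "f \<noteq> a" using f(4) s(3) a(2) by auto
      then have "h p > 0" using simple_refl_pos[OF a(1)] f by simp
      moreover have "h \<noteq> a"
      proof
        assume "h = a"
        then have "f p = a (?s p)" using f(1) s(2) by (metis comp_apply)
        then show False using f(3) s(3) simple_pos[OF a(1)] by simp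
      qed
      ultimately show "h \<in> ?N g - {a}" using f root_comp s(1) by auto
    qed
    moreover have "inj_on (\<lambda>f. f \<circ> ?s) (?N (?s \<circ> g))"
    proof (rule inj_onI)
      fix f h assume "f \<circ> ?s = h \<circ> ?s"
      then have "f (?s (?s x)) = h (?s (?s x))" for x by (metis comp_apply)
      then show "f = h" using s(2) by (simp add: fun_eq_iff)
    qed
    ultimately have "card (?N (?s \<circ> g)) \<le> card (?N g - {a})"
      using finite_inversions[OF less.prems] by (intro card_inj_on_le) auto
    also have "\<dots> < card (?N g)"
      using a simple_root simple_pos finite_inversions[OF less.prems]
      by (intro psubset_card_mono) auto
    finally obtain w \<tau> where "w \<in> generated S" "\<tau> \<in> stab" and eq: "?s \<circ> g = w \<circ> \<tau>"
      using less.hyps[OF _ sg] by blast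
    moreover have "g = (?s \<circ> w) \<circ> \<tau>"
      unfolding comp_assoc eq[symmetric] using s(2) by (simp add: fun_eq_iff)
    moreover have "?s \<circ> w \<in> generated S"
      using a(1) calculation(1) comp_generated generator_generated by blast
    ultimately show ?thesis by blast
  qed
qed

text \<open>At this point \<open>refl f\<close> is only known to lie in \<open>G\<close>, so it is
  split as \<open>w \<circ> \<tau>\<close>. A reflection inverts its own positive root,
  \<open>w\<close> inverts the same roots, and a word for \<open>w\<close> then leads to a simple
  root.\<close>

lemma refl_conj_simple:
  assumes "f \<in> \<Phi>"
  obtains v a where "v \<in> generated S" "a \<in> \<Delta>" "refl f \<circ> v = v \<circ> refl a"
proof -
  obtain h where h: "h \<in> \<Phi>" "h p > 0" "refl h = refl f"
    using root_translate[OF id_mem assms] by (metis comp_id id_comp)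
  obtain w \<tau> where w: "w \<in> generated S" "\<tau> \<in> stab" "refl h = w \<circ> \<tau>"
    using decompose[OF refl_mem[OF h(1)]] by blast
  have wG: "w \<in> G" using w(1) generated_subset by blast
  have "h (w (\<tau> p)) = - h p" using root_refl[OF h(1)] w(3) by (metis comp_apply)
  then have "h (w p) < 0"
    using h(2) stab_sign_comp[OF w(2) h(1) wG] root_sign[OF h(1) wG] by force
  then obtain v where v: "v \<in> generated S" "h \<circ> v \<in> \<Delta>"
    using inversion_conj_simple w(1) h by blast
  then have "refl f \<circ> v = v \<circ> refl (h \<circ> v)"
    using refl_conj_comp[OF h(1)] generated_subset h(3) by (metis subsetD)
  then show thesis using that v by blast
qed

text \<open>Reconciles the reflections of the Coxeter system, which enter
  \<open>coxeter_bruhat_le\<close>, with the reflections in hyperplanes, which enter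
  \<open>ascent\<close>.\<close>

lemma conjugates_eq: "conjugates S = refl ` \<Phi>"
proof (intro equalityI subsetI)
  fix t assume "t \<in> conjugates S"
  then obtain w a where w: "w \<in> generated S" "a \<in> \<Delta>" and t: "t = w \<circ> refl a \<circ> inv_into UNIV w"
    unfolding conjugates_def by blast
  have wG: "w \<in> G" using w(1) generated_subset by blast
  obtain w' where "w' \<circ> w = id" "w \<circ> w' = id" using inv_generated[OF w(1)] by blast
  then have inv: "w \<circ> inv_into UNIV w = id" by (metis inv_unique_comp)
  obtain f where "f \<in> \<Phi>" "refl f \<circ> w = w \<circ> refl a"
    using root_translate[OF wG simple_root[OF w(2)]] by blast
  then show "t \<in> refl ` \<Phi>" using t comp_cancel_right[OF inv] by (metis imageI)
next
  fix t assume "t \<in> refl ` \<Phi>"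
  then obtain f where "f \<in> \<Phi>" and t: "t = refl f" by blast
  then obtain v a where v: "v \<in> generated S" "a \<in> \<Delta>" "refl f \<circ> v = v \<circ> refl a"
    using refl_conj_simple by metis
  obtain v' where "v' \<circ> v = id" "v \<circ> v' = id" using inv_generated[OF v(1)] by blast
  then have "v \<circ> inv_into UNIV v = id" by (metis inv_unique_comp)
  then have "t = v \<circ> refl a \<circ> inv_into UNIV v" using v(3) t comp_cancel_right by metis
  then show "t \<in> conjugates S" using v unfolding conjugates_def by blast
qed

lemma refl_generated: "f \<in> \<Phi> \<Longrightarrow> refl f \<in> generated S"
proof -
  assume "f \<in> \<Phi>"
  then obtain v a where v: "v \<in> generated S" "a \<in> \<Delta>" "refl f \<circ> v = v \<circ> refl a"
    using refl_conj_simple by metis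
  obtain v' where v': "v' \<in> generated S" "v \<circ> v' = id" using inv_generated[OF v(1)] by blast
  then have "refl f = v \<circ> refl a \<circ> v'" using v(3) comp_cancel_right by metis
  then show ?thesis using v v' comp_generated generator_generated by (metis imageI)
qed

lemma generated_reflections: "generated (refl ` \<Phi>) = generated S"
proof
  interpret T: involutions "refl ` \<Phi>"
    by unfold_locales (auto simp: fun_eq_iff refl_refl)
  show "generated S \<subseteq> generated (refl ` \<Phi>)"
    using simple_root by (intro T.generated_mono) blast
  show "generated (refl ` \<Phi>) \<subseteq> generated S"
  proof
    fix w assume "w \<in> generated (refl ` \<Phi>)"
    then show "w \<in> generated S"
      by (induction rule: T.generated_induct) (blast intro: id_generated comp_generated refl_generated)+
  qed
qed

text \<open>Exchange shortens \<open>w\<close> when the sign is negative. When it is positive, the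
  same applies to \<open>refl f \<circ> w\<close>, where the sign is reversed.\<close>

lemma word_length_less_refl_iff:
  assumes "w \<in> generated S" "f \<in> \<Phi>" "f p > 0"
  shows "word_length S w < word_length S (refl f \<circ> w) \<longleftrightarrow> f (w p) > 0"
proof
  assume *: "f (w p) > 0"
  have "refl f \<circ> w \<in> generated S" using assms refl_generated comp_generated by blast
  moreover have "f ((refl f \<circ> w) p) < 0" using * root_refl[OF assms(2)] by simp
  moreover have "refl f \<circ> (refl f \<circ> w) = w" using refl_refl[OF assms(2)] by (simp add: fun_eq_iff)
  ultimately show "word_length S w < word_length S (refl f \<circ> w)"
    using word_length_refl_less[of "refl f \<circ> w" f] assms by metis
next
  assume *: "word_length S w < word_length S (refl f \<circ> w)"
  have "f (w p) \<noteq> 0" using root_sign assms generated_subset by blast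
  then show "f (w p) > 0"
    using * word_length_refl_less[OF assms] by fastforce
qed

text \<open>If a reduced word began with the reflection in \<open>a\<close>, positivity of
  \<open>a\<close> at \<open>w p\<close> would make \<open>a\<close> negative at the image of
  \<open>p\<close> under the tail, and exchange would write \<open>w\<close> with fewer letters than
  the tail.\<close>

lemma generated_stab_eq_id:
  assumes "w \<in> generated S" "w \<in> stab" shows "w = id"
proof -
  obtain ss where ss: "set ss \<subseteq> S" "w = word_prod ss" "length ss = word_length S w"
    using reduced_word[OF assms(1)] .
  show ?thesis
  proof (cases ss)
    case Nil
    then show ?thesis using ss(2) word_prod_Nil by metis
  next
    case (Cons s ts)
    then obtain a where a: "a \<in> \<Delta>" "s = refl a" using ss(1) by auto
    have a': "a \<in> \<Phi>" "a p > 0" using a simple_root simple_pos by blast+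
    have w: "w = refl a \<circ> word_prod ts" using ss(2) Cons a(2) word_prod_Cons by metis
    have "a (w p) > 0" using stab_sign[OF assms(2)] a' by blast
    then have "a (word_prod ts p) < 0" using w root_refl[OF a'(1)] by simp
    then obtain us where "set us \<subseteq> S" "length us < length ts" "w = word_prod us"
      using exchange[OF _ a', of ts] ss(1) Cons w by (metis set_subset_Cons subset_trans)
    then show ?thesis using word_length_le[of us] ss(3) Cons by simp
  qed
qed

text \<open>With \<open>u\<close> inverse to \<open>w'\<close>, the product
  \<open>u \<circ> w\<close> sends \<open>\<tau>\<close> to \<open>\<tau>'\<close>; it therefore
  changes no sign at \<open>p\<close> and is trivial. This makes the \<open>THE\<close> in
  \<open>ext_length\<close> unambiguous.\<close>

lemma decompose_unique:
  assumes "w \<in> generated S" "w' \<in> generated S" "\<tau> \<in> stab" "\<tau>' \<in> stab" "w \<circ> \<tau> = w' \<circ> \<tau>'"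
  shows "w = w'"
proof -
  obtain u where u: "u \<in> generated S" "u \<circ> w' = id" "w' \<circ> u = id" using inv_generated[OF assms(2)] by blast
  have v: "u \<circ> w \<in> generated S" using u(1) assms(1) by (rule comp_generated)
  then have vG: "u \<circ> w \<in> G" using generated_subset by blast
  have "u \<circ> w \<circ> \<tau> = \<tau>'"
    unfolding comp_assoc assms(5) by (intro comp_cancel_left u)
  then have "f ((u \<circ> w) p) > 0" if "f \<in> \<Phi>" "f p > 0" for f
    using stab_sign_comp[OF assms(3) that(1) vG] stab_sign[OF assms(4) that(1)] that(2)
    by (metis comp_apply)
  then have "u \<circ> w \<in> stab" using vG unfolding stab_def by blast
  then have "w' \<circ> (u \<circ> w) = w' \<circ> id" using v generated_stab_eq_id by metis
  then show ?thesis by (simp only: comp_cancel_left[OF u(3)] comp_id)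
qed

text \<open>The right factor is a reflection by \<open>conjugates_eq\<close>,
  \<open>root_translate\<close> moves it to the left, and \<open>word_length_less_refl_iff\<close>
  turns the length condition into a sign.\<close>

lemma coxeter_bruhat_le_eq: "coxeter_bruhat_le S = (\<lambda>u v. u \<in> generated S \<and> ascent u v)\<^sup>*\<^sup>*"
proof -
  have "(\<exists>t\<in>conjugates S. v = u \<circ> t) \<and> word_length S u < word_length S v \<longleftrightarrow> ascent u v"
    if u: "u \<in> generated S" for u v
  proof -
    have uG: "u \<in> G" using u generated_subset by blast
    show ?thesis
    proof
      assume *: "(\<exists>t\<in>conjugates S. v = u \<circ> t) \<and> word_length S u < word_length S v"
      then obtain h where "h \<in> \<Phi>" "v = u \<circ> refl h" unfolding conjugates_eq by blast
      then obtain f where f: "f \<in> \<Phi>" "f p > 0" "v = refl f \<circ> u" using root_translate[OF uG] by metis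
      have "f (u p) > 0" using * unfolding f(3) word_length_less_refl_iff[OF u f(1,2)] by (rule conjunct2)
      with f show "ascent u v" using uG unfolding ascent_def by (intro conjI bexI[of _ f])
    next
      assume "ascent u v"
      then obtain f where f: "f \<in> \<Phi>" "f p > 0" "f (u p) > 0" "v = refl f \<circ> u"
        unfolding ascent_def by blast
      have "v = u \<circ> refl (f \<circ> u)"
        unfolding f(4) by (rule refl_conj_comp[OF f(1) uG refl])
      moreover have "refl (f \<circ> u) \<in> conjugates S"
        unfolding conjugates_eq using root_comp[OF f(1) uG] by (rule imageI)
      moreover have "word_length S u < word_length S v"
        unfolding f(4) using word_length_less_refl_iff[OF u f(1,2)] f(3) by (rule iffD2)
      ultimately show "(\<exists>t\<in>conjugates S. v = u \<circ> t) \<and> word_length S u < word_length S v"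
        by (intro conjI bexI)
    qed
  qed
  then have "(\<lambda>u v. u \<in> generated S \<and> (\<exists>t\<in>conjugates S. v = u \<circ> t) \<and> word_length S u < word_length S v)
    = (\<lambda>u v. u \<in> generated S \<and> ascent u v)" by (intro ext conj_cong refl)
  then show ?thesis unfolding coxeter_bruhat_le_def by (rule arg_cong)
qed

text \<open>The factor \<open>\<tau>\<close> does not affect signs at \<open>p\<close>, so one root
  witnesses both ascents.\<close>

lemma ascent_stab_iff:
  assumes "u \<in> generated S" "\<tau> \<in> stab"
  shows "ascent (u \<circ> \<tau>) y \<longleftrightarrow> (\<exists>v\<in>generated S. y = v \<circ> \<tau> \<and> ascent u v)"
proof -
  have uG: "u \<in> G" "u \<circ> \<tau> \<in> G" using assms generated_subset stab_mem comp_mem by blast+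
  show ?thesis
  proof
    assume "ascent (u \<circ> \<tau>) y"
    then obtain f where f: "f \<in> \<Phi>" "f p > 0" "f ((u \<circ> \<tau>) p) > 0" and y: "y = refl f \<circ> (u \<circ> \<tau>)"
      unfolding ascent_def by blast
    have "f (u p) > 0" using f(3) stab_sign_comp[OF assms(2) f(1) uG(1)] by simp
    then have "ascent u (refl f \<circ> u)" unfolding ascent_def using f(1,2) uG(1) by blast
    moreover have "refl f \<circ> u \<in> generated S" using f(1) refl_generated comp_generated assms(1) by blast
    moreover have "y = (refl f \<circ> u) \<circ> \<tau>" unfolding y by (rule comp_assoc[symmetric])
    ultimately show "\<exists>v\<in>generated S. y = v \<circ> \<tau> \<and> ascent u v" by blast
  next
    assume "\<exists>v\<in>generated S. y = v \<circ> \<tau> \<and> ascent u v"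
    then obtain v f where f: "f \<in> \<Phi>" "f p > 0" "f (u p) > 0" and y: "y = v \<circ> \<tau>" "v = refl f \<circ> u"
      unfolding ascent_def by blast
    have "f ((u \<circ> \<tau>) p) > 0" using f(3) stab_sign_comp[OF assms(2) f(1) uG(1)] by simp
    moreover have "y = refl f \<circ> (u \<circ> \<tau>)" unfolding y by (rule comp_assoc)
    ultimately show "ascent (u \<circ> \<tau>) y" unfolding ascent_def using f(1,2) uG(2) by blast
  qed
qed

lemma below_stab_iff:
  assumes "u \<in> generated S" "\<tau> \<in> stab"
  shows "below (u \<circ> \<tau>) y \<longleftrightarrow> (\<exists>v\<in>generated S. y = v \<circ> \<tau> \<and> coxeter_bruhat_le S u v)"
proof
  assume "below (u \<circ> \<tau>) y"
  then show "\<exists>v\<in>generated S. y = v \<circ> \<tau> \<and> coxeter_bruhat_le S u v"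
    unfolding below_def coxeter_bruhat_le_eq
  proof (induction rule: rtranclp_induct)
    case base
    then show ?case using assms(1) by blast
  next
    case (step y z)
    then obtain v where v: "v \<in> generated S" "y = v \<circ> \<tau>"
      and uv: "(\<lambda>u v. u \<in> generated S \<and> ascent u v)\<^sup>*\<^sup>* u v" by blast
    obtain v' where v': "v' \<in> generated S" "z = v' \<circ> \<tau>" "ascent v v'"
      using step(2) ascent_stab_iff[OF v(1) assms(2)] unfolding v(2) by blast
    have "(\<lambda>u v. u \<in> generated S \<and> ascent u v)\<^sup>*\<^sup>* u v'"
      using uv v(1) v'(3) by (intro rtranclp.rtrancl_into_rtrancl[OF uv] conjI)
    then show ?case using v' by blast
  qed
next
  assume "\<exists>v\<in>generated S. y = v \<circ> \<tau> \<and> coxeter_bruhat_le S u v"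
  then obtain v where "v \<in> generated S" "y = v \<circ> \<tau>" "coxeter_bruhat_le S u v" by blast
  from this(3) have "below (u \<circ> \<tau>) (v \<circ> \<tau>)"
    unfolding coxeter_bruhat_le_eq
  proof (induction rule: rtranclp_induct)
    case (step v w)
    then have "w \<in> generated S"
      using refl_generated comp_generated unfolding ascent_def by blast
    then have "ascent (v \<circ> \<tau>) (w \<circ> \<tau>)" using step(2) ascent_stab_iff[OF _ assms(2)] by blast
    then show ?case using step(3) ascent_below below_trans by blast
  qed (rule below_refl)
  then show "below (u \<circ> \<tau>) y" using \<open>y = v \<circ> \<tau>\<close> by simp
qed

text \<open>Minimality in a coset supplies a weak inequality of lengths. It suffices:
  \<open>u'\<close> is \<open>refl f \<circ> u\<close>, which would be strictly shorter than
  \<open>u\<close> if \<open>f\<close> were negative at \<open>u p\<close>.\<close>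

lemma ascent_of_word_length_le:
  assumes "u \<in> generated S" "u' \<in> generated S" "\<tau> \<in> stab" "\<tau>' \<in> stab" "s \<in> S"
    and eq: "u \<circ> \<tau> \<circ> s = u' \<circ> \<tau>'" and le: "word_length S u \<le> word_length S u'"
  shows "ascent (u \<circ> \<tau>) (u \<circ> \<tau> \<circ> s)"
proof -
  have uG: "u \<in> G" "u \<circ> \<tau> \<in> G" using assms generated_subset stab_mem comp_mem by blast+
  obtain a where a: "a \<in> \<Delta>" "s = refl a" using assms(5) by blast
  obtain f where f: "f \<in> \<Phi>" "f p > 0" "refl f \<circ> (u \<circ> \<tau>) = u \<circ> \<tau> \<circ> s"
    using root_translate[OF uG(2) simple_root[OF a(1)]] a(2) by metis
  have "refl f \<circ> u \<in> generated S" using f(1) refl_generated comp_generated assms(1) by blast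
  moreover have "refl f \<circ> u \<circ> \<tau> = u' \<circ> \<tau>'" unfolding eq[symmetric] f(3)[symmetric] by (rule comp_assoc)
  ultimately have "refl f \<circ> u = u'" using decompose_unique assms(2-4) by blast
  then have "\<not> f (u p) < 0" using word_length_refl_less[OF assms(1) f(1,2)] le by auto
  then have "f (u p) > 0" using root_sign[OF f(1) uG(1)] by simp
  then have "f ((u \<circ> \<tau>) p) > 0" using stab_sign_comp[OF assms(3) f(1) uG(1)] by simp
  then show ?thesis unfolding ascent_def f(3)[symmetric] using f(1,2) uG(2) by blast
qed

end

section \<open>Root data\<close>

lemma additive_zscale:
  assumes "Modules.additive f" shows "f (zscale k x) = zscale k (f x)"
  by (simp add: zscale_def additive.diff[OF assms] additive.sum[OF assms])

lemma zscale_int: "zscale k (n :: int) = k * n"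
  by (cases "k \<ge> 0") (simp_all add: zscale_def)

lemma zscale_real_vector: "zscale k (v :: 'v::real_vector) = of_int k *\<^sub>R v"
  by (cases "k \<ge> 0") (simp_all add: zscale_def sum_constant_scaleR)

context based_reduced_root_datum
begin

lemma pairing_right:
  "pairing D x (y + z) = pairing D x y + pairing D x z"
  "pairing D x (y - z) = pairing D x y - pairing D x z"
  "pairing D x (- y) = - pairing D x y"
  "pairing D x (zscale k y) = k * pairing D x y"
  using pairing_additive_right[of x]
  by (simp_all add: additive.add additive.diff additive.minus additive_zscale zscale_int)

lemma pairing_left:
  "pairing D (x + x') y = pairing D x y + pairing D x' y"
  "pairing D (x - x') y = pairing D x y - pairing D x' y"
  "pairing D (- x) y = - pairing D x y"
  "pairing D (zscale k x) y = k * pairing D x y"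
  using additive.add[OF pairing_additive_left] additive.diff[OF pairing_additive_left]
    additive.minus[OF pairing_additive_left] additive_zscale[OF pairing_additive_left]
  by (simp_all add: zscale_int)

lemma character_eqI: "(\<And>y. pairing D x y = pairing D x' y) \<Longrightarrow> x = x'"
  using perfect_right[OF pairing_additive_right[of x]] by (auto simp: fun_eq_iff)

lemma cocharacter_eqI: "(\<And>x. pairing D x y = pairing D x y') \<Longrightarrow> y = y'"
  using perfect_left[OF pairing_additive_left[of y]] by (auto simp: fun_eq_iff)

lemma cocharacter_torsion_free:
  fixes y :: 'y
  assumes "zscale n y = zscale m y" "n \<noteq> m" shows "y = 0"
proof (rule cocharacter_eqI)
  fix x
  have "n * pairing D x y = m * pairing D x y"
    using arg_cong[OF assms(1), of "pairing D x"] by (simp add: pairing_right)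
  moreover have "pairing D x 0 = 0" using additive.zero[OF pairing_additive_right] .
  ultimately show "pairing D x y = pairing D x 0" using assms(2) by simp
qed

section \<open>Coroots are determined by their roots\<close>

lemma reflect_coroot_mem:
  "\<alpha> \<in> roots D \<Longrightarrow> y \<in> coroot D ` roots D \<Longrightarrow> y - zscale (pairing D \<alpha> y) (coroot D \<alpha>) \<in> coroot D ` roots D"
  using reflect_coroots by blast

text \<open>If \<open>\<delta>\<close> also gave a reflection of the coroots, then composing the two reflections would be
  the transvection \<open>y \<mapsto> y - \<langle>\<gamma>, y\<rangle>(\<delta> - \<gamma>\<^sup>\<or>)\<close>, which has infinite order.\<close>

lemma coroot_unique:
  assumes \<gamma>: "\<gamma> \<in> roots D" and two: "pairing D \<gamma> \<delta> = 2"
    and pres: "\<And>y. y \<in> coroot D ` roots D \<Longrightarrow> y - zscale (pairing D \<gamma> y) \<delta> \<in> coroot D ` roots D"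
  shows "\<delta> = coroot D \<gamma>"
proof -
  define \<epsilon> where "\<epsilon> = \<delta> - coroot D \<gamma>"
  have \<epsilon>: "pairing D \<gamma> \<epsilon> = 0" using two pairing_coroot[OF \<gamma>] by (simp add: \<epsilon>_def pairing_right)
  \<comment> \<open>The iterates of the transvection on the coroot of \<open>\<gamma>\<close>. Each
    of them pairs to 2 with \<open>\<gamma>\<close>, so every step subtracts
    \<open>2 \<epsilon>\<close>.\<close>
  let ?y = "\<lambda>n :: nat. coroot D \<gamma> - zscale (2 * int n) \<epsilon>"
  have "?y n \<in> coroot D ` roots D" for n
  proof (induction n)
    case 0
    then show ?case using \<gamma> by simp
  next
    case (Suc n)
    have "pairing D \<gamma> (?y n) = 2" using \<epsilon> pairing_coroot[OF \<gamma>] by (simp add: pairing_right)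
    then have *: "?y n - zscale 2 \<delta> \<in> coroot D ` roots D" using pres[OF Suc] by simp
    have "pairing D \<gamma> (?y n - zscale 2 \<delta>) = - 2"
      using \<epsilon> two pairing_coroot[OF \<gamma>] by (simp add: pairing_right)
    then have "?y n - zscale 2 \<delta> - zscale (- 2) (coroot D \<gamma>) \<in> coroot D ` roots D"
      using reflect_coroot_mem[OF \<gamma> *] by simp
    moreover have "?y n - zscale 2 \<delta> - zscale (- 2) (coroot D \<gamma>) = ?y (Suc n)"
      by (simp add: \<epsilon>_def int_module.scale_left_distrib int_module.scale_right_diff_distrib
        int_module.scale_minus_left algebra_simps)
    ultimately show ?case by (simp only:)
  qed
  then have "finite (range ?y)"
    by (intro finite_subset[OF _ finite_imageI[OF finite_roots]]) blast
  then obtain n m where "n \<noteq> m" "?y n = ?y m"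
    using finite_imageD[of ?y UNIV] infinite_UNIV_nat unfolding inj_def by blast
  then have "\<epsilon> = 0" using cocharacter_torsion_free[of "2 * int n" \<epsilon> "2 * int m"] by simp
  then show ?thesis by (simp add: \<epsilon>_def)
qed

lemma root_minus: "\<alpha> \<in> roots D \<Longrightarrow> - \<alpha> \<in> roots D"
proof -
  assume \<alpha>: "\<alpha> \<in> roots D"
  have "zscale 2 \<alpha> = \<alpha> + \<alpha>" using int_module.scale_left_distrib[of 1 1 \<alpha>] by simp
  then show ?thesis using reflect_roots[OF \<alpha> \<alpha>] pairing_coroot[OF \<alpha>] by simp
qed

lemma coroot_minus: "\<alpha> \<in> roots D \<Longrightarrow> coroot D (- \<alpha>) = - coroot D \<alpha>"
proof (rule sym, rule coroot_unique)
  assume \<alpha>: "\<alpha> \<in> roots D"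
  then show "- \<alpha> \<in> roots D" by (rule root_minus)
  show "pairing D (- \<alpha>) (- coroot D \<alpha>) = 2"
    using pairing_coroot[OF \<alpha>] by (simp add: pairing_left pairing_right)
  fix y assume "y \<in> coroot D ` roots D"
  then show "y - zscale (pairing D (- \<alpha>) y) (- coroot D \<alpha>) \<in> coroot D ` roots D"
    using reflect_coroot_mem[OF \<alpha>] by (simp add: pairing_left)
qed

text \<open>The axioms say that a reflected coroot is some coroot, but not of which root;
  \<open>coroot_unique\<close> decides this.\<close>

lemma coroot_reflect:
  assumes \<alpha>: "\<alpha> \<in> roots D" and \<beta>: "\<beta> \<in> roots D"
  shows "coroot D (\<alpha> - zscale (pairing D \<alpha> (coroot D \<beta>)) \<beta>)
    = coroot D \<alpha> - zscale (pairing D \<beta> (coroot D \<alpha>)) (coroot D \<beta>)" (is "coroot D ?\<gamma> = ?\<delta>")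
proof (rule sym, rule coroot_unique)
  show "?\<gamma> \<in> roots D" using reflect_roots assms by blast
  show "pairing D ?\<gamma> ?\<delta> = 2"
    using pairing_coroot[OF \<alpha>] pairing_coroot[OF \<beta>]
    by (simp add: pairing_left pairing_right algebra_simps)
  \<comment> \<open>The reflection given by \<open>?\<gamma>\<close> and \<open>?\<delta>\<close> is
    the conjugate by this involution of the one given by \<open>\<alpha>\<close> and its
    coroot.\<close>
  define \<sigma> where "\<sigma> y = y - zscale (pairing D \<beta> y) (coroot D \<beta>)" for y
  have \<sigma>_mem: "\<sigma> y \<in> coroot D ` roots D" if "y \<in> coroot D ` roots D" for y
    unfolding \<sigma>_def using \<beta> that by (rule reflect_coroot_mem)
  have \<sigma>_\<sigma>: "\<sigma> (\<sigma> y) = y" for y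
  proof -
    have "pairing D \<beta> (\<sigma> y) = - pairing D \<beta> y"
      using pairing_coroot[OF \<beta>] by (simp add: \<sigma>_def pairing_right)
    then show ?thesis unfolding \<sigma>_def[of "\<sigma> y"] by (simp add: \<sigma>_def)
  qed
  have \<sigma>_diff: "\<sigma> (y - zscale k z) = \<sigma> y - zscale k (\<sigma> z)" for y z k
    by (simp add: \<sigma>_def pairing_right int_module.scale_left_diff_distrib
      int_module.scale_right_diff_distrib)
  fix y assume "y \<in> coroot D ` roots D"
  then have "\<sigma> y \<in> coroot D ` roots D" by (rule \<sigma>_mem)
  then have "\<sigma> y - zscale (pairing D \<alpha> (\<sigma> y)) (coroot D \<alpha>) \<in> coroot D ` roots D"
    by (rule reflect_coroot_mem[OF \<alpha>])
  then have "y - zscale (pairing D \<alpha> (\<sigma> y)) (\<sigma> (coroot D \<alpha>)) \<in> coroot D ` roots D"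
    using \<sigma>_mem[of "\<sigma> y - zscale (pairing D \<alpha> (\<sigma> y)) (coroot D \<alpha>)"] by (simp add: \<sigma>_diff \<sigma>_\<sigma>)
  moreover have "pairing D \<alpha> (\<sigma> y) = pairing D ?\<gamma> y"
    by (simp add: \<sigma>_def pairing_left pairing_right)
  ultimately show "y - zscale (pairing D ?\<gamma> y) ?\<delta> \<in> coroot D ` roots D"
    by (simp add: \<sigma>_def)
qed

end

subsection \<open>The real pairing\<close>

context based_reduced_real_root_datum
begin

lemma emb_simps:
  "emb D (y + z) = emb D y + emb D z" "emb D (y - z) = emb D y - emb D z"
  "emb D (- y) = - emb D y" "emb D 0 = 0" "emb D (zscale k y) = of_int k *\<^sub>R emb D y"
  using emb_additive
  by (simp_all add: additive.add additive.diff additive.minus additive.zero additive_zscale zscale_real_vector)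

lemma linear_eq_on_lattice:
  fixes f g :: "'v \<Rightarrow> real"
  assumes "linear f" "linear g" "\<And>y. f (emb D y) = g (emb D y)"
  shows "f = g"
proof
  fix v
  obtain B where "span (emb D ` B) = UNIV" using emb_basis by blast
  then show "f v = g v" using linear_eq_on_span[OF assms(1,2), of "emb D ` B" v] assms(3) by auto
qed

text \<open>Values prescribed on the real basis extend linearly; induction over the integer span of
  \<open>B\<close> carries the formula to the whole lattice.\<close>

lemma real_pairing_exists: "\<exists>f :: 'v \<Rightarrow> real. linear f \<and> (\<forall>y. f (emb D y) = of_int (pairing D x y))"
proof -
  obtain B where B: "is_zbasis B" "inj_on (emb D) B" "independent (emb D ` B)"
    using emb_basis by blast
  obtain f :: "'v \<Rightarrow> real" where f: "linear f"
    "\<forall>v\<in>emb D ` B. f v = of_int (pairing D x (inv_into B (emb D) v))"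
    using linear_independent_extend[OF B(3), of "\<lambda>v. of_int (pairing D x (inv_into B (emb D) v))"] by blast
  have "f (emb D y) = of_int (pairing D x y)" for y
  proof -
    have "y \<in> int_module.span B" using B(1) by (simp add: is_zbasis_def)
    then show ?thesis
    proof (induction rule: int_module.span_induct)
      case base
      have "pairing D x 0 = 0" using additive.zero[OF pairing_additive_right] .
      then show ?case
        by (auto simp: int_module.subspace_def emb_simps pairing_right
          linear_0[OF f(1)] linear_add[OF f(1)] linear_scale[OF f(1)])
    next
      case (step y)
      then show ?case using f(2) B(2) by simp
    qed
  qed
  then show ?thesis using f(1) by blast
qed

lemma real_pairing_eqI:
  assumes "linear f" "\<And>y. f (emb D y) = of_int (pairing D x y)" shows "real_pairing D x = f"
  unfolding real_pairing_def
proof (rule the_equality)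
  show "linear f \<and> (\<forall>y. f (emb D y) = of_int (pairing D x y))" using assms by blast
  fix g :: "'v \<Rightarrow> real" assume "linear g \<and> (\<forall>y. g (emb D y) = of_int (pairing D x y))"
  then show "g = f" using assms by (intro linear_eq_on_lattice) auto
qed

lemma linear_real_pairing: "linear (real_pairing D x)"
  and real_pairing_emb: "real_pairing D x (emb D y) = of_int (pairing D x y)"
  using real_pairing_exists[of x] real_pairing_eqI[of _ x] by auto

lemmas real_pairing_simps =
  linear_add[OF linear_real_pairing] linear_diff[OF linear_real_pairing]
  linear_neg[OF linear_real_pairing] linear_scale[OF linear_real_pairing]
  linear_0[OF linear_real_pairing] real_pairing_emb

lemma real_pairing_minus: "real_pairing D (- x) v = - real_pairing D x v"
  by (subst real_pairing_eqI[of "\<lambda>v. - real_pairing D x v"])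
    (simp_all add: pairing_left real_pairing_emb linear_compose_neg linear_real_pairing)

lemma real_pairing_diff_zscale:
  "real_pairing D (x - zscale k x') v = real_pairing D x v - of_int k * real_pairing D x' v"
  by (subst real_pairing_eqI[of "\<lambda>v. real_pairing D x v - of_int k * real_pairing D x' v"])
    (auto simp: pairing_left real_pairing_simps algebra_simps intro!: linearI)

lemma real_pairing_inj:
  assumes "real_pairing D x = real_pairing D x'" shows "x = x'"
proof (rule character_eqI)
  fix y show "pairing D x y = pairing D x' y"
    using real_pairing_emb[of x y] real_pairing_emb[of x' y] assms by simp
qed

lemma continuous_on_real_pairing: "continuous_on UNIV (real_pairing D x)"
proof -
  obtain B where "is_zbasis B" "span (emb D ` B) = UNIV" using emb_basis by blast
  then show ?thesis
    using continuous_on_linear_functional[OF _ _ linear_real_pairing] unfolding is_zbasis_def by blast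
qed

end

section \<open>Affine roots and the extended affine Weyl group\<close>

context based_reduced_real_root_datum
begin

section \<open>Affine roots as functions\<close>

definition aff :: "'x \<Rightarrow> int \<Rightarrow> 'v \<Rightarrow> real"
  where "aff \<alpha> k v = real_pairing D \<alpha> v + of_int k"

definition affine_roots :: "('v \<Rightarrow> real) set"
  where "affine_roots = {aff \<alpha> k | \<alpha> k. \<alpha> \<in> roots D}"

text \<open>Treating affine roots as functions lets group elements act by composition. The linear
  part, needed to find the coroot, is recovered here and is well defined by
  \<open>aff_inj\<close>.\<close>

definition gradient :: "('v \<Rightarrow> real) \<Rightarrow> 'x"
  where "gradient f = (THE \<alpha>. \<exists>k. f = aff \<alpha> k)"

definition refl :: "('v \<Rightarrow> real) \<Rightarrow> 'v \<Rightarrow> 'v"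
  where "refl f v = v - f v *\<^sub>R emb D (coroot D (gradient f))"

lemma aff_affine_root: "\<alpha> \<in> roots D \<Longrightarrow> aff \<alpha> k \<in> affine_roots"
  unfolding affine_roots_def by blast

lemma affine_rootE:
  assumes "f \<in> affine_roots" obtains \<alpha> k where "\<alpha> \<in> roots D" "f = aff \<alpha> k"
  using assms unfolding affine_roots_def by blast

lemma aff_diff: "aff \<alpha> k (v - c *\<^sub>R w) = aff \<alpha> k v - c * real_pairing D \<alpha> w"
  by (simp add: aff_def real_pairing_simps)

lemma aff_inj: assumes "aff \<alpha> k = aff \<beta> m" shows "\<alpha> = \<beta>"
proof -
  have "aff \<alpha> k 0 = aff \<beta> m 0" using assms by simp
  then have "k = m" by (simp add: aff_def real_pairing_simps)
  then have "real_pairing D \<alpha> v = real_pairing D \<beta> v" for v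
    using fun_cong[OF assms, of v] by (simp add: aff_def)
  then show ?thesis using real_pairing_inj by blast
qed

lemma gradient_aff: "gradient (aff \<alpha> k) = \<alpha>"
  unfolding gradient_def using aff_inj by blast

lemma refl_aff: "refl (aff \<alpha> k) = affine_reflection D \<alpha> k"
  by (rule ext) (simp add: refl_def gradient_aff affine_reflection_def aff_def)

lemma aff_minus: "- aff \<alpha> k = aff (- \<alpha>) (- k)"
  by (rule ext) (simp add: aff_def real_pairing_minus)

lemma affine_root_minus: "f \<in> affine_roots \<Longrightarrow> - f \<in> affine_roots"
  by (elim affine_rootE) (simp add: aff_minus aff_affine_root root_minus)

lemma affine_root_coroot: "\<alpha> \<in> roots D \<Longrightarrow> real_pairing D \<alpha> (emb D (coroot D \<alpha>)) = 2"
  by (simp add: real_pairing_emb pairing_coroot)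

lemma root_refl: assumes "f \<in> affine_roots" shows "f (refl f v) = - f v"
  using assms by (elim affine_rootE) (simp add: refl_def gradient_aff aff_diff affine_root_coroot)

lemma refl_refl: assumes "f \<in> affine_roots" shows "refl f (refl f v) = v"
  using root_refl[OF assms, of v] by (simp add: refl_def)

lemma refl_minus: assumes "f \<in> affine_roots" shows "refl (- f) = refl f"
proof -
  obtain \<alpha> k where \<alpha>: "\<alpha> \<in> roots D" and f: "f = aff \<alpha> k" using assms by (rule affine_rootE)
  have "gradient (- f) = - gradient f" unfolding f aff_minus gradient_aff by (rule refl)
  then show ?thesis
    using coroot_minus[OF \<alpha>] by (intro ext) (simp add: refl_def f gradient_aff emb_simps)
qed

text \<open>The two demands that \<open>root_arrangement\<close> makes on how group elements act on
  roots, gathered into a property stable under composition, so that translations and linear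
  reflections are the only cases to check.\<close>

definition compatible :: "('v \<Rightarrow> 'v) \<Rightarrow> bool"
  where "compatible g \<longleftrightarrow>
    (\<forall>f\<in>affine_roots. f \<circ> g \<in> affine_roots \<and> (\<forall>v. g (refl (f \<circ> g) v) = refl f (g v)))"

lemma compatible_comp:
  assumes "compatible g" "compatible h" shows "compatible (g \<circ> h)"
  unfolding compatible_def
proof (intro ballI conjI allI)
  fix f v assume f: "f \<in> affine_roots"
  then have fg: "f \<circ> g \<in> affine_roots" using assms(1) unfolding compatible_def by blast
  then show "f \<circ> (g \<circ> h) \<in> affine_roots"
    using assms(2) unfolding compatible_def comp_assoc[symmetric] by blast
  have "h (refl (f \<circ> g \<circ> h) v) = refl (f \<circ> g) (h v)"
    using fg assms(2) unfolding compatible_def by blast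
  moreover have "g (refl (f \<circ> g) (h v)) = refl f (g (h v))"
    using f assms(1) unfolding compatible_def by blast
  ultimately show "(g \<circ> h) (refl (f \<circ> (g \<circ> h)) v) = refl f ((g \<circ> h) v)"
    by (simp add: comp_assoc)
qed

lemma compatible_transl: "compatible (transl D \<nu>)"
  unfolding compatible_def
proof (intro ballI conjI allI)
  fix f v assume "f \<in> affine_roots"
  then obtain \<alpha> k where \<alpha>: "\<alpha> \<in> roots D" and f: "f = aff \<alpha> k" by (rule affine_rootE)
  have eq: "f \<circ> transl D \<nu> = aff \<alpha> (k + pairing D \<alpha> \<nu>)"
    by (rule ext) (simp add: f aff_def transl_def real_pairing_simps)
  show "f \<circ> transl D \<nu> \<in> affine_roots" unfolding eq using \<alpha> by (rule aff_affine_root)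
  have "f (transl D \<nu> v) = aff \<alpha> (k + pairing D \<alpha> \<nu>) v" using fun_cong[OF eq, of v] by simp
  then show "transl D \<nu> (refl (f \<circ> transl D \<nu>) v) = refl f (transl D \<nu> v)"
    unfolding eq by (simp add: refl_def gradient_aff f) (simp add: transl_def)
qed

lemma linear_affine_reflection: "linear (affine_reflection D \<beta> 0)"
  by (rule linearI) (simp_all add: affine_reflection_def real_pairing_simps algebra_simps)

lemma affine_reflection_emb:
  "affine_reflection D \<beta> 0 (emb D \<nu>) = emb D (\<nu> - zscale (pairing D \<beta> \<nu>) (coroot D \<beta>))"
  by (simp add: affine_reflection_def emb_simps real_pairing_emb)

lemma compatible_affine_reflection:
  assumes \<beta>: "\<beta> \<in> roots D" shows "compatible (affine_reflection D \<beta> 0)"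
  unfolding compatible_def
proof (intro ballI conjI allI)
  let ?s = "affine_reflection D \<beta> 0"
  fix f v assume "f \<in> affine_roots"
  then obtain \<alpha> k where \<alpha>: "\<alpha> \<in> roots D" and f: "f = aff \<alpha> k" by (rule affine_rootE)
  define \<gamma> where "\<gamma> = \<alpha> - zscale (pairing D \<alpha> (coroot D \<beta>)) \<beta>"
  have \<gamma>: "\<gamma> \<in> roots D" unfolding \<gamma>_def using \<beta> \<alpha> by (rule reflect_roots)
  have eq: "f \<circ> ?s = aff \<gamma> k"
    by (rule ext) (simp add: f \<gamma>_def affine_reflection_def aff_diff real_pairing_emb, simp add: aff_def real_pairing_diff_zscale)
  show "f \<circ> ?s \<in> affine_roots" unfolding eq using \<gamma> by (rule aff_affine_root)
  \<comment> \<open>The root \<open>\<gamma>\<close> is the reflection of \<open>\<alpha>\<close>,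
    so by \<open>coroot_reflect\<close> its coroot is the reflection of that of
    \<open>\<alpha>\<close>; reflecting once more returns.\<close>
  have "coroot D \<alpha> = coroot D \<gamma> - zscale (pairing D \<beta> (coroot D \<gamma>)) (coroot D \<beta>)"
    unfolding \<gamma>_def coroot_reflect[OF \<alpha> \<beta>] using pairing_coroot[OF \<beta>]
    by (simp add: pairing_right)
  then have "?s (emb D (coroot D \<gamma>)) = emb D (coroot D \<alpha>)"
    by (simp add: affine_reflection_emb)
  moreover have "f (?s v) = aff \<gamma> k v" using fun_cong[OF eq, of v] by simp
  ultimately show "?s (refl (f \<circ> ?s) v) = refl f (?s v)"
    unfolding eq by (simp add: refl_def gradient_aff f linear_diff linear_scale linear_affine_reflection)
qed

section \<open>Group structure of the extended affine Weyl group\<close>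

sublocale finite_weyl: involutions "{affine_reflection D \<alpha> 0 | \<alpha>. \<alpha> \<in> roots D}"
proof
  fix s assume "s \<in> {affine_reflection D \<alpha> 0 | \<alpha>. \<alpha> \<in> roots D}"
  then obtain \<alpha> where "\<alpha> \<in> roots D" "s = refl (aff \<alpha> 0)" using refl_aff by auto
  then show "s \<circ> s = id" using refl_refl[OF aff_affine_root] by (simp add: fun_eq_iff)
qed

lemma finite_weyl_facts:
  assumes "w \<in> finite_weyl D"
  shows "linear w \<and> (\<forall>\<nu>. \<exists>\<nu>'. w (emb D \<nu>) = emb D \<nu>') \<and> compatible w"
  using assms unfolding finite_weyl_def
proof (induction rule: finite_weyl.generated_induct)
  case id
  have "compatible id" by (simp add: compatible_def)
  moreover have "\<exists>\<nu>'. id (emb D \<nu>) = emb D \<nu>'" for \<nu> by auto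
  ultimately show ?case using linear_id by blast
next
  case (comp s w)
  then obtain \<alpha> where \<alpha>: "\<alpha> \<in> roots D" and s: "s = affine_reflection D \<alpha> 0" by blast
  have "linear (s \<circ> w)"
    using comp.IH linear_compose linear_affine_reflection unfolding s by blast
  moreover have "compatible (s \<circ> w)"
    using comp.IH compatible_comp compatible_affine_reflection[OF \<alpha>] unfolding s by blast
  moreover have "\<exists>\<nu>'. (s \<circ> w) (emb D \<nu>) = emb D \<nu>'" for \<nu>
  proof -
    obtain \<nu>' where "w (emb D \<nu>) = emb D \<nu>'" using comp.IH by blast
    then show ?thesis unfolding s by (auto simp: affine_reflection_emb)
  qed
  ultimately show ?case by blast
qed

lemma ext_weylI: "w \<in> finite_weyl D \<Longrightarrow> transl D \<nu> \<circ> w \<in> ext_weyl D"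
  unfolding ext_weyl_def by blast

lemma ext_weylE:
  assumes "g \<in> ext_weyl D" obtains \<nu> w where "w \<in> finite_weyl D" "g = transl D \<nu> \<circ> w"
  using assms unfolding ext_weyl_def by blast

lemma id_finite_weyl: "id \<in> finite_weyl D"
  unfolding finite_weyl_def by (rule finite_weyl.id_generated)

lemma transl_zero: "transl D 0 = id"
  by (rule ext) (simp add: transl_def emb_simps)

lemma transl_ext_weyl: "transl D \<nu> \<in> ext_weyl D"
  using ext_weylI[OF id_finite_weyl, of \<nu>] by (simp only: comp_id)

lemma finite_weyl_ext_weyl: "w \<in> finite_weyl D \<Longrightarrow> w \<in> ext_weyl D"
  using ext_weylI[of w 0] by (simp only: transl_zero id_comp)

lemma compatible_ext_weyl: "g \<in> ext_weyl D \<Longrightarrow> compatible g"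
  by (elim ext_weylE) (simp only: compatible_comp compatible_transl finite_weyl_facts)

lemma finite_weyl_transl:
  assumes "w \<in> finite_weyl D" obtains \<nu>' where "w \<circ> transl D \<nu> = transl D \<nu>' \<circ> w"
proof -
  obtain \<nu>' where \<nu>': "w (emb D \<nu>) = emb D \<nu>'" and "linear w"
    using finite_weyl_facts[OF assms] by blast
  then have "w \<circ> transl D \<nu> = transl D \<nu>' \<circ> w"
    by (intro ext) (simp add: transl_def linear_add)
  then show thesis by (rule that)
qed

lemma transl_comp: "transl D \<nu> \<circ> transl D \<nu>' = transl D (\<nu> + \<nu>')"
  by (rule ext) (simp add: transl_def emb_simps add_ac)

lemma ext_weyl_comp:
  assumes "g \<in> ext_weyl D" "h \<in> ext_weyl D" shows "g \<circ> h \<in> ext_weyl D"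
proof -
  obtain \<nu> w where w: "w \<in> finite_weyl D" "g = transl D \<nu> \<circ> w" using assms(1) by (rule ext_weylE)
  obtain \<nu>' w' where w': "w' \<in> finite_weyl D" "h = transl D \<nu>' \<circ> w'" using assms(2) by (rule ext_weylE)
  obtain \<nu>'' where \<nu>'': "w \<circ> transl D \<nu>' = transl D \<nu>'' \<circ> w" using w(1) by (rule finite_weyl_transl)
  have "g \<circ> h = transl D \<nu> \<circ> (w \<circ> transl D \<nu>') \<circ> w'" unfolding w(2) w'(2) by (simp only: comp_assoc)
  also have "\<dots> = (transl D \<nu> \<circ> transl D \<nu>'') \<circ> (w \<circ> w')" unfolding \<nu>'' by (simp only: comp_assoc)
  also have "\<dots> = transl D (\<nu> + \<nu>'') \<circ> (w \<circ> w')" by (simp only: transl_comp)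
  also have "\<dots> \<in> ext_weyl D"
    using w(1) w'(1) unfolding finite_weyl_def
    by (intro ext_weylI[unfolded finite_weyl_def] finite_weyl.comp_generated)
  finally show ?thesis .
qed

lemma ext_weyl_inv:
  assumes "g \<in> ext_weyl D" shows "\<exists>h\<in>ext_weyl D. h \<circ> g = id \<and> g \<circ> h = id"
proof -
  obtain \<nu> w where w: "w \<in> finite_weyl D" "g = transl D \<nu> \<circ> w" using assms by (rule ext_weylE)
  obtain w' where w': "w' \<in> finite_weyl D" "w' \<circ> w = id" "w \<circ> w' = id"
    using finite_weyl.inv_generated w(1) unfolding finite_weyl_def by blast
  have t: "transl D (- \<nu>) \<circ> transl D \<nu> = id" "transl D \<nu> \<circ> transl D (- \<nu>) = id"
    unfolding transl_comp by (simp_all only: left_minus right_minus transl_zero)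
  have "w' \<circ> transl D (- \<nu>) \<in> ext_weyl D"
    using ext_weyl_comp finite_weyl_ext_weyl[OF w'(1)] transl_ext_weyl by blast
  moreover have "(w' \<circ> transl D (- \<nu>)) \<circ> g = id"
    unfolding w(2) comp_assoc comp_cancel_left[OF t(1)] by (rule w'(2))
  moreover have "g \<circ> (w' \<circ> transl D (- \<nu>)) = id"
    unfolding w(2) comp_assoc comp_cancel_left[OF w'(3)] by (rule t(2))
  ultimately show ?thesis by blast
qed

lemma affine_reflection_ext_weyl:
  assumes "\<alpha> \<in> roots D" shows "affine_reflection D \<alpha> k \<in> ext_weyl D"
proof -
  have "affine_reflection D \<alpha> k = transl D (zscale (- k) (coroot D \<alpha>)) \<circ> affine_reflection D \<alpha> 0"
    by (rule ext) (simp add: affine_reflection_def transl_def emb_simps algebra_simps)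
  moreover have "affine_reflection D \<alpha> 0 \<in> finite_weyl D"
    unfolding finite_weyl_def using assms by (intro finite_weyl.generator_generated) blast
  ultimately show ?thesis using ext_weylI by simp
qed

lemma refl_ext_weyl: "f \<in> affine_roots \<Longrightarrow> refl f \<in> ext_weyl D"
  by (elim affine_rootE) (simp only: refl_aff affine_reflection_ext_weyl)

lemma affine_reflections_eq: "{affine_reflection D \<alpha> k | \<alpha> k. \<alpha> \<in> roots D} = refl ` affine_roots"
  unfolding affine_roots_def by (auto simp: refl_aff[symmetric])

lemma affine_hyperplane_eq:
  assumes "\<alpha> \<in> roots D" shows "affine_hyperplane D \<alpha> k = {v. aff \<alpha> k v = 0}"
proof -
  have "emb D (coroot D \<alpha>) \<noteq> 0"
    using affine_root_coroot[OF assms] real_pairing_simps(5)[of \<alpha>] by auto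
  then show ?thesis by (auto simp: affine_hyperplane_def affine_reflection_def aff_def)
qed

text \<open>Conjugating a translation sees only the linear part of the reflection, so the
  cocharacter is replaced by its linear reflection and stays in the orbit.\<close>

lemma transl_reflect:
  assumes "f \<in> affine_roots" "\<nu> \<in> weyl_orbit D \<mu>"
  obtains \<nu>' where "\<nu>' \<in> weyl_orbit D \<mu>" "refl f \<circ> transl D \<nu> \<circ> refl f = transl D \<nu>'"
proof -
  obtain \<alpha> k where \<alpha>: "\<alpha> \<in> roots D" and f: "f = aff \<alpha> k" using assms(1) by (rule affine_rootE)
  let ?s = "affine_reflection D \<alpha> 0"
  let ?\<nu>' = "\<nu> - zscale (pairing D \<alpha> \<nu>) (coroot D \<alpha>)"
  obtain w where w: "w \<in> finite_weyl D" "emb D \<nu> = w (emb D \<mu>)"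
    using assms(2) unfolding weyl_orbit_def by blast
  have "?s \<circ> w \<in> finite_weyl D"
    using w(1) \<alpha> unfolding finite_weyl_def
    by (blast intro: finite_weyl.comp_generated finite_weyl.generator_generated)
  moreover have "emb D ?\<nu>' = (?s \<circ> w) (emb D \<mu>)"
    using w(2) affine_reflection_emb[of \<alpha> \<nu>] by simp
  ultimately have "?\<nu>' \<in> weyl_orbit D \<mu>" unfolding weyl_orbit_def by blast
  moreover have "refl f \<circ> transl D \<nu> \<circ> refl f = transl D ?\<nu>'"
  proof
    fix v
    have "f (refl f v + emb D \<nu>) = - f v + real_pairing D \<alpha> (emb D \<nu>)"
      using root_refl[OF assms(1), of v] by (simp add: f aff_def real_pairing_simps)
    then show "(refl f \<circ> transl D \<nu> \<circ> refl f) v = transl D ?\<nu>' v"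
      by (simp add: refl_def[of f "_ + _"] transl_def)
        (simp add: refl_def f gradient_aff emb_simps real_pairing_emb algebra_simps)
  qed
  ultimately show thesis by (rule that)
qed

end

section \<open>The base alcove\<close>

context based_reduced_real_root_datum
begin

lemma affine_root_combination:
  assumes "f \<in> affine_roots" "u + v = 1"
  shows "f (u *\<^sub>R x + v *\<^sub>R y) = u * f x + v * f y"
proof -
  obtain \<alpha> k where f: "f = aff \<alpha> k" using assms(1) by (rule affine_rootE)
  have "u * of_int k + v * of_int k = (of_int k :: real)"
    using assms(2) by (metis distrib_right mult_1)
  then show ?thesis by (simp add: f aff_def real_pairing_simps algebra_simps)
qed

lemma affine_root_segment:
  "f \<in> affine_roots \<Longrightarrow> f (x + c *\<^sub>R (y - x)) = f x + c * (f y - f x)"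
  using affine_root_combination[of f "1 - c" c x y] by (simp add: algebra_simps)

lemma continuous_on_affine_root: "f \<in> affine_roots \<Longrightarrow> continuous_on UNIV f"
  by (elim affine_rootE)
    (simp add: aff_def[abs_def] continuous_on_add continuous_on_const continuous_on_real_pairing)

lemma affine_zero_set: "f \<in> affine_roots \<Longrightarrow> affine {v. f v = 0}"
  unfolding affine_def by (simp add: affine_root_combination)

lemma base_alcove_bounds:
  assumes "\<alpha> \<in> roots D"
  shows "(\<forall>x\<in>base_alcove D. -1 < real_pairing D \<alpha> x \<and> real_pairing D \<alpha> x < 0) \<or>
    (\<forall>x\<in>base_alcove D. 0 < real_pairing D \<alpha> x \<and> real_pairing D \<alpha> x < 1)"
  using simple_base[OF assms]
proof
  assume "- \<alpha> \<in> positive_roots D"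
  then have "-1 < real_pairing D (- \<alpha>) x \<and> real_pairing D (- \<alpha>) x < 0" if "x \<in> base_alcove D" for x
    using that unfolding base_alcove_def by blast
  then show ?thesis unfolding real_pairing_minus by force
qed (auto simp: base_alcove_def)

text \<open>On the alcove each root takes values in (-1,0) or in (0,1), so the integer
  \<open>k\<close> decides the sign of \<open>\<alpha> + k\<close>. The weak hypothesis, with
  \<open>x = y\<close>, also shows that no affine root vanishes on the alcove.\<close>

lemma alcove_sign:
  assumes "f \<in> affine_roots" "x \<in> base_alcove D" "y \<in> base_alcove D" "f x \<ge> 0"
  shows "f y > 0"
proof -
  obtain \<alpha> k where \<alpha>: "\<alpha> \<in> roots D" and f: "f = aff \<alpha> k" using assms(1) by (rule affine_rootE)
  show ?thesis
    using base_alcove_bounds[OF \<alpha>]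
  proof
    assume *: "\<forall>x\<in>base_alcove D. -1 < real_pairing D \<alpha> x \<and> real_pairing D \<alpha> x < 0"
    then have "of_int k > (0 :: real)" using assms(2,4) by (fastforce simp: f aff_def)
    then have "of_int k \<ge> (1 :: real)" by simp
    then show ?thesis using * assms(3) by (fastforce simp: f aff_def)
  next
    assume *: "\<forall>x\<in>base_alcove D. 0 < real_pairing D \<alpha> x \<and> real_pairing D \<alpha> x < 1"
    then have "of_int k > (-1 :: real)" using assms(2,4) by (fastforce simp: f aff_def)
    then have "of_int k \<ge> (0 :: real)" by simp
    then show ?thesis using * assms(3) by (fastforce simp: f aff_def)
  qed
qed

definition alcove_inequalities :: "('v \<Rightarrow> real) set"
  where "alcove_inequalities =
    (\<lambda>\<alpha>. aff (- \<alpha>) 0) ` positive_roots D \<union> (\<lambda>\<alpha>. aff \<alpha> 1) ` positive_roots D"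

lemma positive_roots_subset: "positive_roots D \<subseteq> roots D"
  unfolding positive_roots_def by blast

lemma finite_alcove_inequalities: "finite alcove_inequalities"
  unfolding alcove_inequalities_def
  using finite_subset[OF positive_roots_subset finite_roots] by simp

lemma alcove_inequalities_subset: "alcove_inequalities \<subseteq> affine_roots"
  unfolding alcove_inequalities_def
  using positive_roots_subset root_minus aff_affine_root by blast

lemma base_alcove_eq: "base_alcove D = {x. \<forall>f\<in>alcove_inequalities. f x > 0}"
  unfolding base_alcove_def alcove_inequalities_def
  by (auto simp: ball_Un aff_def real_pairing_minus)

text \<open>Take a defining subsystem of least cardinality. Dropping \<open>f\<close> enlarges the
  region, and a new point must violate \<open>f\<close>.\<close>

lemma irredundant_inequalities:
  obtains I where "I \<subseteq> alcove_inequalities" "base_alcove D = {x. \<forall>f\<in>I. f x > 0}"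
    "\<And>f. f \<in> I \<Longrightarrow> \<exists>x. f x \<le> 0 \<and> (\<forall>g\<in>I - {f}. g x > 0)"
proof -
  let ?P = "\<lambda>I. I \<subseteq> alcove_inequalities \<and> base_alcove D = {x. \<forall>f\<in>I. f x > 0}"
  have "?P alcove_inequalities" using base_alcove_eq by blast
  then obtain I where I: "?P I" and min: "\<And>J. ?P J \<Longrightarrow> card I \<le> card J"
    using ex_has_least_nat[of ?P alcove_inequalities card] by blast
  have "finite I" using I finite_alcove_inequalities finite_subset by blast
  show thesis
  proof (rule that[of I])
    fix f assume f: "f \<in> I"
    have "card (I - {f}) < card I" using f \<open>finite I\<close> by (rule card_Diff1_less[rotated])
    then have "\<not> ?P (I - {f})" using min[of "I - {f}"] by linarith
    then have "base_alcove D \<noteq> {x. \<forall>g\<in>I - {f}. g x > 0}" using I by blast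
    moreover have "base_alcove D \<subseteq> {x. \<forall>g\<in>I - {f}. g x > 0}" using I by blast
    ultimately obtain x where x: "\<forall>g\<in>I - {f}. g x > 0" "x \<notin> base_alcove D" by blast
    then have "\<not> (\<forall>g\<in>I. g x > 0)" using I by blast
    then have "f x \<le> 0" using x(1) by (metis Diff_iff not_less singletonD)
    then show "\<exists>x. f x \<le> 0 \<and> (\<forall>g\<in>I - {f}. g x > 0)" using x(1) by blast
  qed (use I in blast)+
qed

lemma finite_sign_changes: "finite {f \<in> affine_roots. f x > 0 \<and> f y < 0}"
proof -
  \<comment> \<open>A sign change forces \<open>k\<close> strictly between the two real numbers
    whose floor and ceiling bound this interval.\<close>
  let ?K = "\<lambda>\<alpha>. {\<lfloor>- real_pairing D \<alpha> x\<rfloor>..\<lceil>- real_pairing D \<alpha> y\<rceil>}"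
  have "{f \<in> affine_roots. f x > 0 \<and> f y < 0} \<subseteq> (\<lambda>(\<alpha>, k). aff \<alpha> k) ` Sigma (roots D) ?K"
  proof
    fix f assume f: "f \<in> {f \<in> affine_roots. f x > 0 \<and> f y < 0}"
    then obtain \<alpha> k where \<alpha>: "\<alpha> \<in> roots D" "f = aff \<alpha> k" by (blast elim: affine_rootE)
    then have "- real_pairing D \<alpha> x < of_int k" "of_int k < - real_pairing D \<alpha> y"
      using f by (simp_all add: aff_def)
    then have "k \<in> ?K \<alpha>" by (simp add: floor_le_iff le_ceiling_iff)
    then show "f \<in> (\<lambda>(\<alpha>, k). aff \<alpha> k) ` Sigma (roots D) ?K" using \<alpha> by force
  qed
  then show ?thesis by (rule finite_subset) (intro finite_imageI finite_SigmaI finite_roots finite_atLeastAtMost_int)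
qed

lemma is_wall_minus: "is_wall D (- \<alpha>) (- k) \<longleftrightarrow> is_wall D \<alpha> k"
proof -
  have *: "is_wall D (- \<alpha>) (- k)" if "is_wall D \<alpha> k" for \<alpha> k
  proof -
    have \<alpha>: "\<alpha> \<in> roots D" using that by (simp add: is_wall_def)
    have "aff (- \<alpha>) (- k) v = 0 \<longleftrightarrow> aff \<alpha> k v = 0" for v
      unfolding aff_minus[symmetric] by simp
    then have "affine_hyperplane D (- \<alpha>) (- k) = affine_hyperplane D \<alpha> k"
      using affine_hyperplane_eq \<alpha> root_minus[OF \<alpha>] by simp
    then show ?thesis using that root_minus unfolding is_wall_def by simp
  qed
  show ?thesis using *[of \<alpha> k] *[of "- \<alpha>" "- k"] by auto
qed

text \<open>The inclusion makes the two roots proportional, and the root system is reduced.\<close>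

lemma affine_root_eq_of_hyperplane_subset:
  assumes f: "f \<in> affine_roots" and h: "h \<in> affine_roots" and sub: "\<And>v. f v = 0 \<Longrightarrow> h v = 0"
  shows "h = f \<or> h = - f"
proof -
  obtain \<alpha> k where \<alpha>: "\<alpha> \<in> roots D" and f: "f = aff \<alpha> k" using f by (rule affine_rootE)
  obtain \<beta> m where \<beta>: "\<beta> \<in> roots D" and h: "h = aff \<beta> m" using h by (rule affine_rootE)
  define n where "n = pairing D \<beta> (coroot D \<alpha>)"
  have prop_eq: "2 * h v = of_int n * f v" for v
  proof -
    \<comment> \<open>The projection of \<open>v\<close> to the zero set of \<open>f\<close> along
      the coroot; the 2 is the pairing of a root with its coroot.\<close>
    let ?y = "v - (f v / 2) *\<^sub>R emb D (coroot D \<alpha>)"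
    have "f ?y = 0" unfolding f aff_diff by (simp add: affine_root_coroot[OF \<alpha>])
    then have "h ?y = 0" by (rule sub)
    then show ?thesis unfolding h aff_diff by (simp add: real_pairing_emb n_def mult.commute)
  qed
  have "2 * real_pairing D \<beta> v = of_int n * real_pairing D \<alpha> v" for v
    using prop_eq[of v] prop_eq[of 0] by (simp add: f h aff_def real_pairing_simps algebra_simps)
  moreover have "real_pairing D (zscale j x) v = of_int j * real_pairing D x v" for j x v
    using real_pairing_diff_zscale[of 0 "- j" x v] real_pairing_diff_zscale[of 0 1 0 v] by simp
  ultimately have "real_pairing D (zscale 2 \<beta>) = real_pairing D (zscale n \<alpha>)"
    by (intro ext) simp
  then have "zscale 2 \<beta> = zscale n \<alpha>" by (rule real_pairing_inj)
  then have "\<beta> = \<alpha> \<or> \<beta> = - \<alpha>" using reduced[OF \<alpha> \<beta>, of 2 n] by simp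
  then have "n = 2 \<or> n = - 2"
    unfolding n_def using pairing_coroot[OF \<alpha>] by (auto simp: pairing_left)
  then show ?thesis using prop_eq by (auto simp: fun_eq_iff)
qed

end

text \<open>The arrangement reads off positivity at one point; by \<open>alcove_sign\<close> all
  points of the alcove give the same signs.\<close>

locale root_datum_alcove_point = based_reduced_real_root_datum D
  for D :: "('x::ab_group_add, 'y::ab_group_add, 'v::real_normed_vector) real_root_datum" +
  fixes p :: 'v
  assumes p: "p \<in> base_alcove D"
begin

section \<open>Walls and simple affine roots\<close>

lemma alcove_sign_iff:
  assumes "f \<in> affine_roots" "x \<in> base_alcove D" shows "f x > 0 \<longleftrightarrow> f p > 0"
  using alcove_sign[OF assms(1) p assms(2)] alcove_sign[OF assms(1) assms(2) p] by auto

lemma affine_root_nonzero: "f \<in> affine_roots \<Longrightarrow> f p \<noteq> 0"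
  using alcove_sign[OF _ p p] by force

definition simple_affine_roots :: "('v \<Rightarrow> real) set"
  where "simple_affine_roots = {aff \<alpha> k | \<alpha> k. is_wall D \<alpha> k \<and> aff \<alpha> k p > 0}"

lemma simple_affine_rootE:
  assumes "a \<in> simple_affine_roots"
  obtains "a \<in> affine_roots" "a p > 0" "affine hull ({v. a v = 0} \<inter> closure (base_alcove D)) = {v. a v = 0}"
  using assms affine_hyperplane_eq aff_affine_root
  unfolding simple_affine_roots_def is_wall_def by fastforce

lemma simple_reflections_eq: "simple_reflections D = refl ` simple_affine_roots"
proof
  show "refl ` simple_affine_roots \<subseteq> simple_reflections D"
    unfolding simple_affine_roots_def simple_reflections_def using refl_aff by blast
  show "simple_reflections D \<subseteq> refl ` simple_affine_roots"
  proof
    fix s assume "s \<in> simple_reflections D"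
    then obtain \<alpha> k where w: "is_wall D \<alpha> k" and s: "s = refl (aff \<alpha> k)"
      unfolding simple_reflections_def refl_aff[symmetric] by blast
    have f: "aff \<alpha> k \<in> affine_roots" using w aff_affine_root unfolding is_wall_def by blast
    show "s \<in> refl ` simple_affine_roots"
    proof (cases "aff \<alpha> k p > 0")
      case True
      then show ?thesis using w s unfolding simple_affine_roots_def by blast
    next
      case False
      then have "aff (- \<alpha>) (- k) p > 0"
        using affine_root_nonzero[OF f] unfolding aff_minus[symmetric] by simp
      moreover have "s = refl (aff (- \<alpha>) (- k))" using refl_minus[OF f] s unfolding aff_minus by simp
      ultimately show ?thesis using w is_wall_minus unfolding simple_affine_roots_def by blast
    qed
  qed
qed

lemma closure_nonneg:
  assumes "f \<in> affine_roots" "f p > 0" "x \<in> closure (base_alcove D)" shows "f x \<ge> 0"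
proof -
  have "closed {x. 0 \<le> f x}"
    using continuous_on_affine_root[OF assms(1)] by (intro closed_Collect_le continuous_on_const)
  moreover have "base_alcove D \<subseteq> {x. 0 \<le> f x}"
    using alcove_sign_iff[OF assms(1)] assms(2) by force
  ultimately have "closure (base_alcove D) \<subseteq> {x. 0 \<le> f x}" by (rule closure_minimal[rotated])
  then show ?thesis using assms(3) by blast
qed

text \<open>Points of the wall are fixed by \<open>refl a\<close>. If \<open>h\<close> were negative
  at \<open>refl a p\<close>, it would be both nonnegative and nonpositive where the wall meets the
  closure, hence zero there and on the affine hull, the whole hyperplane. This forces
  \<open>h = a\<close> or \<open>h = - a\<close>.\<close>

lemma simple_refl_pos:
  assumes a: "a \<in> simple_affine_roots" and h: "h \<in> affine_roots" "h p > 0" "h \<noteq> a"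
  shows "h (refl a p) > 0"
proof (rule ccontr)
  obtain a': "a \<in> affine_roots" "a p > 0"
    and wall: "affine hull ({v. a v = 0} \<inter> closure (base_alcove D)) = {v. a v = 0}"
    using a by (rule simple_affine_rootE)
  assume "\<not> h (refl a p) > 0"
  moreover have hs: "h \<circ> refl a \<in> affine_roots"
    using compatible_ext_weyl[OF refl_ext_weyl[OF a'(1)]] h(1) unfolding compatible_def by blast
  ultimately have neg: "(- (h \<circ> refl a)) p > 0" using affine_root_nonzero[OF hs] by simp
  have "h x = 0" if x: "a x = 0" "x \<in> closure (base_alcove D)" for x
  proof -
    have "refl a x = x" using x(1) by (simp add: refl_def)
    then have "h x \<le> 0" using closure_nonneg[OF affine_root_minus[OF hs] neg x(2)] by simp
    then show ?thesis using closure_nonneg[OF h(1,2) x(2)] by simp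
  qed
  then have "{v. a v = 0} \<inter> closure (base_alcove D) \<subseteq> {v. h v = 0}" by blast
  then have "{v. a v = 0} \<subseteq> {v. h v = 0}"
    using hull_minimal[of _ _ affine, OF _ affine_zero_set[OF h(1)]] wall by metis
  then have "h = a \<or> h = - a" using affine_root_eq_of_hyperplane_subset[OF a'(1) h(1)] by blast
  then show False using h(2,3) a'(2) by auto
qed

text \<open>The segment from \<open>p\<close> to \<open>z\<close>, without its end \<open>z\<close>,
  lies in the alcove, and the points \<open>?x n\<close> on it tend to \<open>z\<close>.\<close>

lemma closure_alcove_of_inequalities:
  assumes I: "I \<subseteq> affine_roots" "base_alcove D = {x. \<forall>f\<in>I. f x > 0}"
    and z: "\<And>f. f \<in> I \<Longrightarrow> f z \<ge> 0"
  shows "z \<in> closure (base_alcove D)"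
proof -
  let ?x = "\<lambda>n. z + inverse (real (Suc n)) *\<^sub>R (p - z)"
  have "?x n \<in> base_alcove D" for n
    unfolding I(2)
  proof (intro CollectI ballI)
    fix f assume f: "f \<in> I"
    let ?c = "inverse (real (Suc n))"
    have c: "0 < ?c" "?c \<le> 1" by (simp_all add: field_simps)
    have "f p > 0" using p f unfolding I(2) by blast
    then have "0 < (1 - ?c) * f z + ?c * f p" using c z[OF f] by (intro add_nonneg_pos) simp_all
    then show "f (?x n) > 0" using affine_root_segment[of f z ?c p] f I(1) by (auto simp: algebra_simps)
  qed
  moreover have "?x \<longlonglongrightarrow> z + 0 *\<^sub>R (p - z)"
    by (intro tendsto_intros LIMSEQ_inverse_real_of_nat)
  ultimately show ?thesis unfolding closure_sequential by (intro exI[of _ ?x]) simp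
qed

text \<open>The segment from \<open>p\<close> to \<open>x\<close> meets the hyperplane in a point
  \<open>y\<close> at which all other inequalities are strict. Near \<open>y\<close> the hyperplane
  therefore lies in the closure, which is enough to span it affinely.\<close>

lemma irredundant_inequality_wall:
  assumes I: "finite I" "I \<subseteq> affine_roots" "base_alcove D = {x. \<forall>f\<in>I. f x > 0}"
    and f: "aff \<alpha> k \<in> I" "\<alpha> \<in> roots D" and x: "aff \<alpha> k x \<le> 0" "\<And>g. g \<in> I - {aff \<alpha> k} \<Longrightarrow> g x > 0"
  shows "is_wall D \<alpha> k"
proof -
  let ?f = "aff \<alpha> k"
  let ?H = "{v. ?f v = 0}"
  have fr: "?f \<in> affine_roots" using f I by blast
  have pos: "g p > 0" if "g \<in> I" for g using p that unfolding I(3) by blast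
  \<comment> \<open>Along the segment \<open>?f\<close> is an affine function of the parameter, with
    value \<open>?f p\<close> at 0 and \<open>?f x\<close> at 1; this is its zero.\<close>
  define t where "t = ?f p / (?f p - ?f x)"
  define y where "y = p + t *\<^sub>R (x - p)"
  have t: "0 < t" "t \<le> 1" using pos[OF f(1)] x(1) by (simp_all add: t_def field_simps)
  have fy: "?f y = 0"
    unfolding y_def affine_root_segment[OF fr] t_def using pos[OF f(1)] x(1) by (simp add: field_simps)
  have gy: "g y > 0" if g: "g \<in> I - {?f}" for g
  proof -
    have "0 < (1 - t) * g p + t * g x" using t x(2)[OF g] pos[of g] g by (intro add_nonneg_pos) simp_all
    then show ?thesis
      unfolding y_def using affine_root_segment[of g p t x] g I(2) by (auto simp: algebra_simps)
  qed
  have "z \<in> affine hull (?H \<inter> closure (base_alcove D))" if z: "?f z = 0" for z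
  proof -
    have "\<forall>\<^sub>F e in at_right 0. g (y + e *\<^sub>R (z - y)) > 0" if g: "g \<in> I - {?f}" for g
    proof -
      have "((\<lambda>e. g y + e * (g z - g y)) \<longlongrightarrow> g y + 0 * (g z - g y)) (at_right 0)"
        by (intro tendsto_intros)
      then have "\<forall>\<^sub>F e in at_right 0. g y + e * (g z - g y) > 0"
        using gy[OF g] by (intro order_tendstoD) simp_all
      then show ?thesis using affine_root_segment[of g] g I(2) by auto
    qed
    then have "\<forall>\<^sub>F e in at_right (0::real). \<forall>g\<in>I - {?f}. g (y + e *\<^sub>R (z - y)) > 0"
      using I(1) by (intro eventually_ball_finite) simp_all
    moreover have "\<forall>\<^sub>F e in at_right (0::real). e > 0" by (rule eventually_at_right_less)
    ultimately have "\<forall>\<^sub>F e in at_right (0::real). e > 0 \<and> (\<forall>g\<in>I - {?f}. g (y + e *\<^sub>R (z - y)) > 0)"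
      by (rule eventually_conj[rotated])
    then obtain e :: real where e: "e > 0" "\<forall>g\<in>I - {?f}. g (y + e *\<^sub>R (z - y)) > 0"
      using eventually_happens'[OF trivial_limit_at_right_real] by blast
    let ?w = "y + e *\<^sub>R (z - y)"
    have w: "?f ?w = 0" using affine_root_segment[OF fr] fy z by simp
    have "?w \<in> closure (base_alcove D)"
    proof (rule closure_alcove_of_inequalities[OF I(2,3)])
      show "g ?w \<ge> 0" if "g \<in> I" for g using that w e(2) by (cases "g = ?f") (auto simp: less_imp_le)
    qed
    moreover have "y \<in> closure (base_alcove D)"
    proof (rule closure_alcove_of_inequalities[OF I(2,3)])
      show "g y \<ge> 0" if "g \<in> I" for g using that fy gy by (cases "g = ?f") (auto simp: less_imp_le)
    qed
    ultimately have "y \<in> affine hull (?H \<inter> closure (base_alcove D))"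
      "?w \<in> affine hull (?H \<inter> closure (base_alcove D))" using fy w by (auto intro: hull_inc)
    \<comment> \<open>The line from \<open>y\<close> through \<open>?w\<close>, extended by the
      factor \<open>1 / e\<close>, reaches \<open>z\<close>.\<close>
    then have "(1 - inverse e) *\<^sub>R y + inverse e *\<^sub>R ?w \<in> affine hull (?H \<inter> closure (base_alcove D))"
      by (intro mem_affine affine_affine_hull) simp_all
    moreover have "(1 - inverse e) *\<^sub>R y + inverse e *\<^sub>R ?w = z"
      using e(1) by (simp add: algebra_simps)
    ultimately show ?thesis by simp
  qed
  moreover have "affine hull (?H \<inter> closure (base_alcove D)) \<subseteq> ?H"
    using affine_zero_set[OF fr] by (intro hull_minimal) auto
  ultimately have "affine hull (?H \<inter> closure (base_alcove D)) = ?H" by blast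
  then show ?thesis using f(2) affine_hyperplane_eq unfolding is_wall_def by simp
qed

text \<open>Every inequality of an irredundant system defines a wall, so the simple affine roots
  contain a system that cuts out the alcove.\<close>

lemma mem_base_alcove_of_simple:
  assumes "\<And>a. a \<in> simple_affine_roots \<Longrightarrow> a x > 0" shows "x \<in> base_alcove D"
proof -
  obtain I where I: "I \<subseteq> alcove_inequalities" "base_alcove D = {x. \<forall>f\<in>I. f x > 0}"
    and irr: "\<And>f. f \<in> I \<Longrightarrow> \<exists>x. f x \<le> 0 \<and> (\<forall>g\<in>I - {f}. g x > 0)"
    using irredundant_inequalities by blast
  have fin: "finite I" "I \<subseteq> affine_roots"
    using I(1) finite_alcove_inequalities alcove_inequalities_subset finite_subset by blast+
  have "f \<in> simple_affine_roots" if f: "f \<in> I" for f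
  proof -
    obtain \<alpha> k where \<alpha>: "\<alpha> \<in> roots D" "f = aff \<alpha> k" using f fin(2) by (blast elim: affine_rootE)
    obtain y where y: "f y \<le> 0" "\<And>g. g \<in> I - {f} \<Longrightarrow> g y > 0" using irr[OF f] by blast
    have "is_wall D \<alpha> k"
      using irredundant_inequality_wall[OF fin I(2) _ \<alpha>(1)] f y unfolding \<alpha>(2) by blast
    moreover have "f p > 0" using p f unfolding I(2) by blast
    ultimately show ?thesis unfolding simple_affine_roots_def \<alpha>(2) by blast
  qed
  then show ?thesis using assms unfolding I(2) by blast
qed

lemma ext_weyl_affine_root: "f \<in> affine_roots \<Longrightarrow> g \<in> ext_weyl D \<Longrightarrow> f \<circ> g \<in> affine_roots"
  using compatible_ext_weyl unfolding compatible_def by blast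

sublocale arr: root_arrangement "ext_weyl D" affine_roots refl simple_affine_roots p
proof
  show "id \<in> ext_weyl D" using finite_weyl_ext_weyl[OF id_finite_weyl] .
  show "g \<circ> h \<in> ext_weyl D" if "g \<in> ext_weyl D" "h \<in> ext_weyl D" for g h
    using that by (rule ext_weyl_comp)
  show "\<exists>h\<in>ext_weyl D. h \<circ> g = id \<and> g \<circ> h = id" if "g \<in> ext_weyl D" for g
    using that by (rule ext_weyl_inv)
  show "f \<circ> g \<in> affine_roots" if "f \<in> affine_roots" "g \<in> ext_weyl D" for f g
    using that by (rule ext_weyl_affine_root)
  show "- f \<in> affine_roots" if "f \<in> affine_roots" for f
    using that by (rule affine_root_minus)
  show "f p \<noteq> 0" if "f \<in> affine_roots" for f
    using that by (rule affine_root_nonzero)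
  show "refl f \<in> ext_weyl D" if "f \<in> affine_roots" for f
    using that by (rule refl_ext_weyl)
  show "refl f (refl f x) = x" if "f \<in> affine_roots" for f x
    using that by (rule refl_refl)
  show "f (refl f x) = - f x" if "f \<in> affine_roots" for f x
    using that by (rule root_refl)
  show "refl (- f) = refl f" if "f \<in> affine_roots" for f
    using that by (rule refl_minus)
  show "g (refl (f \<circ> g) x) = refl f (g x)" if "f \<in> affine_roots" "g \<in> ext_weyl D" for f g x
    using that compatible_ext_weyl unfolding compatible_def by blast
  show "finite {f \<in> affine_roots. 0 < f p \<and> f (g p) < 0}" for g
    by (rule finite_sign_changes)
  show "a \<in> affine_roots" "0 < a p" if "a \<in> simple_affine_roots" for a
    using that by (blast elim: simple_affine_rootE)+
  show "0 < f (refl a p)" if "a \<in> simple_affine_roots" "f \<in> affine_roots" "0 < f p" "f \<noteq> a" for a f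
    using that by (rule simple_refl_pos)
  show "\<exists>a\<in>simple_affine_roots. a (g p) < 0"
    if g: "g \<in> ext_weyl D" and f: "f \<in> affine_roots" "0 < f p" "f (g p) < 0" for g f
  proof (rule ccontr)
    assume *: "\<not> ?thesis"
    \<comment> \<open>If no simple root is negative at \<open>g p\<close>, this point lies in the
      alcove, where every affine root has the sign it has at \<open>p\<close>.\<close>
    have "a (g p) > 0" if a: "a \<in> simple_affine_roots" for a
    proof -
      have "a \<circ> g \<in> affine_roots" using a g ext_weyl_affine_root by (blast elim: simple_affine_rootE)
      then have "a (g p) \<noteq> 0" using affine_root_nonzero by force
      then show ?thesis using * a by force
    qed
    then have "g p \<in> base_alcove D" by (rule mem_base_alcove_of_simple)
    then show False using alcove_sign_iff[OF f(1)] f(2,3) by force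
  qed
qed

text \<open>For a defining inequality \<open>f\<close> the root \<open>f \<circ> \<sigma>\<close> is
  positive at \<open>p\<close>, hence on the whole alcove. So elements of \<open>arr.stab\<close>
  map the alcove into itself; applying this to the inverse as well gives equality.\<close>

lemma alcove_stabilizer_eq: "alcove_stabilizer D = arr.stab"
proof (intro equalityI subsetI)
  fix \<tau> assume "\<tau> \<in> alcove_stabilizer D"
  then have "\<tau> \<in> ext_weyl D" "\<tau> p \<in> base_alcove D" using p unfolding alcove_stabilizer_def by blast+
  then show "\<tau> \<in> arr.stab" using alcove_sign_iff unfolding arr.stab_def by blast
next
  fix \<tau> assume \<tau>: "\<tau> \<in> arr.stab"
  have maps: "\<sigma> x \<in> base_alcove D" if \<sigma>: "\<sigma> \<in> arr.stab" and x: "x \<in> base_alcove D" for \<sigma> x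
    unfolding base_alcove_eq
  proof (intro CollectI ballI)
    fix f assume "f \<in> alcove_inequalities"
    then have f: "f \<in> affine_roots" "f p > 0" using alcove_inequalities_subset p base_alcove_eq by blast+
    have "f \<circ> \<sigma> \<in> affine_roots" using f(1) arr.stab_mem[OF \<sigma>] by (rule ext_weyl_affine_root)
    moreover have "(f \<circ> \<sigma>) p > 0" using arr.stab_sign[OF \<sigma> f(1)] f(2) by simp
    ultimately have "(f \<circ> \<sigma>) x > 0" using alcove_sign_iff x by blast
    then show "f (\<sigma> x) > 0" by simp
  qed
  obtain \<sigma> where \<sigma>: "\<sigma> \<in> ext_weyl D" "\<sigma> \<circ> \<tau> = id" "\<tau> \<circ> \<sigma> = id"
    using ext_weyl_inv[OF arr.stab_mem[OF \<tau>]] by blast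
  have "\<sigma> \<in> arr.stab"
    unfolding arr.stab_def
  proof (intro CollectI conjI ballI impI \<sigma>(1))
    fix f assume f: "f \<in> affine_roots" "f p > 0"
    have "(f \<circ> \<sigma>) (\<tau> p) = f p" using \<sigma>(2) by (metis comp_apply id_apply)
    then show "f (\<sigma> p) > 0"
      using arr.stab_sign[OF \<tau> ext_weyl_affine_root[OF f(1) \<sigma>(1)]] f(2) by simp
  qed
  then have "x = \<tau> (\<sigma> x)" "\<sigma> x \<in> base_alcove D" if "x \<in> base_alcove D" for x
    using maps[OF _ that] \<sigma>(3) by (metis comp_apply id_apply, blast)
  then have "\<tau> ` base_alcove D = base_alcove D" using maps[OF \<tau>] by blast
  then show "\<tau> \<in> alcove_stabilizer D" using arr.stab_mem[OF \<tau>] unfolding alcove_stabilizer_def by blast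
qed

section \<open>Order, length and cosets in terms of signs\<close>

lemma affine_weyl_eq: "affine_weyl D = generated arr.S"
  unfolding affine_weyl_def affine_reflections_eq by (rule arr.generated_reflections)

lemma ext_weyl_decompose:
  assumes "g \<in> ext_weyl D"
  obtains u \<tau> where "u \<in> generated arr.S" "\<tau> \<in> arr.stab" "g = u \<circ> \<tau>"
  using arr.decompose[OF assms] by blast

text \<open>A chain of ascents never changes the stabilizer factor, which is the common
  \<open>\<tau>\<close> of the definition. Membership of \<open>x\<close> is stated because
  \<open>below\<close> is reflexive on arbitrary maps.\<close>

lemma bruhat_le_iff: "bruhat_le D x y \<longleftrightarrow> x \<in> ext_weyl D \<and> arr.below x y"
proof
  assume "bruhat_le D x y"
  then obtain u u' \<tau> where u: "u \<in> generated arr.S" "u' \<in> generated arr.S" "\<tau> \<in> arr.stab"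
    and xy: "x = u \<circ> \<tau>" "y = u' \<circ> \<tau>" "coxeter_bruhat_le arr.S u u'"
    unfolding bruhat_le_def affine_weyl_eq alcove_stabilizer_eq simple_reflections_eq by blast
  have "x \<in> ext_weyl D"
    unfolding xy(1) using u arr.generated_subset arr.stab_mem by (intro ext_weyl_comp) blast+
  moreover have "arr.below x y" using arr.below_stab_iff[OF u(1,3)] u(2) xy by blast
  ultimately show "x \<in> ext_weyl D \<and> arr.below x y" by blast
next
  assume *: "x \<in> ext_weyl D \<and> arr.below x y"
  then obtain u \<tau> where u: "u \<in> generated arr.S" "\<tau> \<in> arr.stab" "x = u \<circ> \<tau>"
    using ext_weyl_decompose by blast
  then obtain u' where "u' \<in> generated arr.S" "y = u' \<circ> \<tau>" "coxeter_bruhat_le arr.S u u'"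
    using arr.below_stab_iff[OF u(1,2)] * by blast
  then show "bruhat_le D x y"
    using u unfolding bruhat_le_def affine_weyl_eq alcove_stabilizer_eq simple_reflections_eq by blast
qed

lemma ext_length_eq:
  assumes "u \<in> generated arr.S" "\<tau> \<in> arr.stab" shows "ext_length D (u \<circ> \<tau>) = word_length arr.S u"
proof -
  have "(THE w. w \<in> affine_weyl D \<and> (\<exists>\<sigma>\<in>alcove_stabilizer D. u \<circ> \<tau> = w \<circ> \<sigma>)) = u"
    unfolding affine_weyl_eq alcove_stabilizer_eq
    using assms arr.decompose_unique by (intro the_equality) blast+
  then show ?thesis unfolding ext_length_def simple_reflections_eq by simp
qed

text \<open>The neighbour \<open>z \<circ> s\<close> lies in the same coset, so it is at least as
  long as \<open>z\<close>; \<open>ascent_of_word_length_le\<close> turns this into an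
  ascent.\<close>

lemma min_coset_rep_ascent:
  assumes J: "J \<subseteq> arr.S" and z: "z \<in> min_coset_reps D J" and s: "s \<in> J"
  shows "z \<in> ext_weyl D" "arr.ascent z (z \<circ> s)"
proof -
  interpret J: involutions J using J by (rule arr.subset)
  obtain x w where x: "x \<in> ext_weyl D" and w: "w \<in> generated J" and zx: "z = x \<circ> w"
    and min: "\<And>w'. w' \<in> generated J \<Longrightarrow> ext_length D z \<le> ext_length D (x \<circ> w')"
    using z unfolding min_coset_reps_def Let_def by blast
  have "w \<in> ext_weyl D" using w arr.generated_mono[OF J] arr.generated_subset by blast
  then show zG: "z \<in> ext_weyl D" unfolding zx using x by (rule ext_weyl_comp[rotated])
  have zs: "z \<circ> s = x \<circ> (w \<circ> s)" unfolding zx by (rule comp_assoc)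
  have "s \<in> ext_weyl D" using s J arr.generator_generated arr.generated_subset by blast
  then have "z \<circ> s \<in> ext_weyl D" using zG by (rule ext_weyl_comp[rotated])
  then obtain u' \<tau>' where u': "u' \<in> generated arr.S" "\<tau>' \<in> arr.stab" "z \<circ> s = u' \<circ> \<tau>'"
    by (rule ext_weyl_decompose)
  obtain u \<tau> where u: "u \<in> generated arr.S" "\<tau> \<in> arr.stab" "z = u \<circ> \<tau>"
    using zG by (rule ext_weyl_decompose)
  have "w \<circ> s \<in> generated J" using w s J.comp_generated J.generator_generated by blast
  then have "ext_length D z \<le> ext_length D (z \<circ> s)" unfolding zs by (rule min)
  then have "word_length arr.S u \<le> word_length arr.S u'"
    unfolding u'(3) unfolding u(3) using ext_length_eq u u' by simp
  then show "arr.ascent z (z \<circ> s)"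
    using arr.ascent_of_word_length_le[OF u(1) u'(1) u(2) u'(2) _ _] u(3) u'(3) s J by blast
qed

text \<open>Conjugation takes reflections to reflections, letter by letter. This is for the other
  half of admissibility: in a product \<open>u \<circ> y \<circ> v\<close> the factor
  \<open>v\<close> can be moved past \<open>y\<close>, so the coset of
  \<open>length_zero_part D \<mu>\<close> is kept.\<close>

lemma affine_weyl_normal:
  assumes "g \<in> ext_weyl D" "v \<in> generated arr.S"
  shows "\<exists>v'\<in>generated arr.S. g \<circ> v = v' \<circ> g"
  using assms(2)
proof (induction rule: arr.generated_induct_right)
  case id
  then show ?case by (intro bexI[OF _ arr.id_generated]) simp
next
  case (comp v s)
  then obtain v' where v': "v' \<in> generated arr.S" "g \<circ> v = v' \<circ> g" by blast
  obtain a where a: "a \<in> simple_affine_roots" "s = refl a" using comp by blast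
  have "g \<circ> v \<in> ext_weyl D"
    using ext_weyl_comp[OF assms(1)] comp(1) arr.generated_subset by blast
  then obtain h where h: "h \<in> affine_roots" "refl h \<circ> (g \<circ> v) = g \<circ> v \<circ> s"
    using arr.root_translate[OF _ arr.simple_root[OF a(1)]] a(2) by metis
  have "g \<circ> (v \<circ> s) = g \<circ> v \<circ> s" by (rule comp_assoc[symmetric])
  also have "\<dots> = refl h \<circ> (g \<circ> v)" by (rule h(2)[symmetric])
  also have "\<dots> = (refl h \<circ> v') \<circ> g" unfolding v'(2) by (rule comp_assoc[symmetric])
  finally have "g \<circ> (v \<circ> s) = (refl h \<circ> v') \<circ> g" .
  moreover have "refl h \<circ> v' \<in> generated arr.S"
    using arr.comp_generated arr.refl_generated h(1) v'(1) by blast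
  ultimately show ?case by blast
qed

theorem Adm_parahoric_min_coset_reps:
  assumes J: "J \<subseteq> simple_reflections D"
  shows "Adm_parahoric D J \<mu> \<inter> min_coset_reps D J = Adm D \<mu> \<inter> min_coset_reps D J"
proof -
  have JS: "J \<subseteq> arr.S" using J unfolding simple_reflections_eq .
  interpret J: involutions J using JS by (rule arr.subset)
  let ?P = "{transl D \<nu> | \<nu>. \<nu> \<in> weyl_orbit D \<mu>}"
  have P: "s \<circ> t \<circ> s \<in> ?P" if s: "s \<in> J" and t: "t \<in> ?P" for s t
  proof -
    obtain f where "f \<in> affine_roots" "s = refl f"
      using s JS arr.simple_root by blast
    then show ?thesis using t transl_reflect by blast
  qed
  have "Adm D \<mu> \<subseteq> Adm_parahoric D J \<mu>"
  proof
    fix x assume "x \<in> Adm D \<mu>"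
    moreover have "x = id \<circ> x \<circ> id" by simp
    ultimately show "x \<in> Adm_parahoric D J \<mu>"
      unfolding Adm_parahoric_def using J.id_generated by blast
  qed
  moreover have "z \<in> Adm D \<mu>" if z: "z \<in> Adm_parahoric D J \<mu>" "z \<in> min_coset_reps D J" for z
  proof -
    obtain u y v where uv: "u \<in> generated J" "v \<in> generated J" and y: "y \<in> Adm D \<mu>" and zy: "z = u \<circ> y \<circ> v"
      using z(1) unfolding Adm_parahoric_def by blast
    obtain w t where w: "w \<in> generated arr.S" "y = w \<circ> length_zero_part D \<mu>"
      and t: "t \<in> ?P" "y \<in> ext_weyl D" "arr.below y t"
      using y unfolding Adm_def bruhat_le_iff affine_weyl_eq by blast
    have gJ: "generated J \<subseteq> generated arr.S" using JS by (rule arr.generated_mono)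
    obtain v' t' where v': "v' \<in> generated J" "t' \<in> ?P" "arr.below (u \<circ> y \<circ> v') t'"
      using arr.coset_meets_below[OF JS P uv(1) t(1,3)] by blast
    \<comment> \<open>Right multiplication by \<open>v'' \<circ> v'\<close> carries \<open>z\<close>
      to the element \<open>u \<circ> y \<circ> v'\<close> of its coset that is known to lie below
      \<open>t'\<close>.\<close>
    obtain v'' where v'': "v'' \<in> generated J" "v \<circ> v'' = id" using J.inv_generated[OF uv(2)] by blast
    have "z \<circ> (v'' \<circ> v') = u \<circ> y \<circ> v'"
      unfolding zy comp_assoc comp_cancel_left[OF v''(2)] ..
    moreover have "arr.below z (z \<circ> (v'' \<circ> v'))"
      using arr.minimal_below_coset[OF JS] min_coset_rep_ascent(2)[OF JS z(2)]
        J.comp_generated[OF v''(1) v'(1)] by blast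
    ultimately have "arr.below z t'" using v'(3) arr.below_trans by metis
    moreover have "z \<in> ext_weyl D"
      unfolding zy using uv gJ arr.generated_subset t(2) by (intro ext_weyl_comp) blast+
    ultimately have "\<exists>\<nu>\<in>weyl_orbit D \<mu>. bruhat_le D z (transl D \<nu>)"
      using v'(2) unfolding bruhat_le_iff by blast
    moreover have "\<exists>w'\<in>affine_weyl D. z = w' \<circ> length_zero_part D \<mu>"
    proof -
      obtain v1 where v1: "v1 \<in> generated arr.S" "y \<circ> v = v1 \<circ> y"
        using affine_weyl_normal[OF t(2)] uv(2) gJ by blast
      have "z = u \<circ> (y \<circ> v)" unfolding zy by (rule comp_assoc)
      also have "\<dots> = (u \<circ> (v1 \<circ> w)) \<circ> length_zero_part D \<mu>"
        unfolding v1(2) unfolding w(2) by (simp only: comp_assoc)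
      finally show ?thesis
        unfolding affine_weyl_eq using uv(1) gJ v1(1) w(1) arr.comp_generated by blast
    qed
    ultimately show ?thesis unfolding Adm_def by blast
  qed
  ultimately show ?thesis by blast
qed

end

theorem proposition5p1:
  fixes D :: "('x::ab_group_add, 'y::ab_group_add, 'v::real_normed_vector) real_root_datum"
    and \<mu> :: 'y and J :: "('v \<Rightarrow> 'v) set"
  assumes "based_reduced_real_root_datum D"
    and "emb D \<mu> \<in> closure (dominant_chamber D)"
    and "J \<subseteq> simple_reflections D"
  shows "Adm_parahoric D J \<mu> \<inter> min_coset_reps D J = Adm D \<mu> \<inter> min_coset_reps D J"
proof (cases "base_alcove D = {}")
  \<comment> \<open>This case does not occur, but an empty alcove has no walls, which forces \<open>J = {}\<close>.\<close>
  case True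
  interpret based_reduced_real_root_datum D by (rule assms(1))
  have "\<not> is_wall D \<alpha> k" for \<alpha> k
  proof
    assume w: "is_wall D \<alpha> k"
    then have \<alpha>: "\<alpha> \<in> roots D" unfolding is_wall_def by blast
    \<comment> \<open>Pairing with \<open>\<alpha>\<close> doubles the coefficient
      \<open>- k / 2\<close>, so this point lies on the hyperplane, while the affine hull of the
      empty set is empty.\<close>
    have "aff \<alpha> k (- (of_int k / 2) *\<^sub>R emb D (coroot D \<alpha>)) = 0"
      by (simp add: aff_def real_pairing_simps pairing_coroot[OF \<alpha>])
    then have "affine_hyperplane D \<alpha> k \<noteq> {}" unfolding affine_hyperplane_eq[OF \<alpha>] by blast
    then show False using w True unfolding is_wall_def by simp
  qed
  then have "J = {}" using assms(3) unfolding simple_reflections_def by blast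
  then have "generated J = {id}"
    using involutions.generated_iff_word[of "{}"] by (auto simp: involutions_def word_prod_def)
  then show ?thesis unfolding Adm_parahoric_def by simp
next
  case False
  then obtain p where "p \<in> base_alcove D" by blast
  then interpret root_datum_alcove_point D p
    using assms(1) by (simp add: root_datum_alcove_point_def root_datum_alcove_point_axioms_def)
  show ?thesis using assms(3) by (rule Adm_parahoric_min_coset_reps)
qed

end
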